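(* Let $B_J\in\mathbb R^{n\times n}$ be irreducible with $B_J\ge O$ elementwise and $\rho(B_J)>0$. Let $\mathcal B$ and $\mathcal B'$ be splittings of $B_J$ of orders $d\ge1$ and $d+1$ (for $d=1$, $\mathcal B=(B_J)$) with $\mathcal B'\succ\mathcal B$. Then: (d1) if $\rho(B_J)<1$ then $\rho(T(\mathcal B'))<\rho(T(\mathcal B))\le\rho(B_J)$; (d2) if $\rho(B_J)=1$ then $\rho(T(\mathcal B'))=\rho(T(\mathcal B))=1$; (d3) if $\rho(B_J)>1$ then $\rho(T(\mathcal B'))>\rho(T(\mathcal B))\ge\rho(B_J)$.
   Context: For $B\in\mathbb R^{n\times n}$, a splitting of $B$ of order $d\ge1$ is an ordered $d$-tuple $\mathcal B=(B_1,\dots,B_d)$ of real $n\times n$ matrices with $B_p\neq O$ for all $p$, $\sum_{p=1}^d B_p=B$, and $B_p\circ B_q=O$ (Hadamard product) for $p\ne q$. The iteration matrix of $\mathcal B$ is the $dn\times dn$ matrix $T(\mathcal B)=(I_{dn}-\mathcal L)^{-1}\mathcal U$, where $\mathcal L,\mathcal U$ are $d\times d$ block matrices with $n\times n$ blocks, $\mathcal L_{ij}=B_j$ if $i>j$ and $O$ otherwise, $\mathcal U_{ij}=B_j$ if $i\le j$ and $O$ otherwise (so $T((B_J))=B_J$). The cyclic shift is $\mathcal S(B_1,\dots,B_d)=(B_d,B_1,\dots,B_{d-1})$, $\mathcal S^r$ its $r$-fold iterate. For splittings $\mathcal B$ of order $d$ and $\mathcal B'$ of order $d+1$ of the same matrix,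 $\mathcal B'\succ\mathcal B$ (refinement) means there exist integers $0\le r\le d-1$, $0\le s\le d$ such that, with $(C_1,\dots,C_d)=\mathcal S^r(\mathcal B)$ and $(C'_1,\dots,C'_{d+1})=\mathcal S^s(\mathcal B')$: (I) $C'_p=C_p$ for $p=1,\dots,d-1$; (II) $(C'_d,C'_{d+1})$ is a splitting of $C_d$; (III) $C'_{d+1}C'_d\ne O$. $\rho$ denotes spectral radius. *)

theory Defs
  imports "Jordan_Normal_Form.Spectral_Radius" "Jordan_Normal_Form.Gauss_Jordan_Elimination"
begin

definition nonneg_mat :: "real mat \<Rightarrow> bool" where
  "nonneg_mat A \<longleftrightarrow> (\<forall>i < dim_row A. \<forall>j < dim_col A. A $$ (i,j) \<ge> 0)"

text \<open>Irreducible: there is no permutation P with P A P^T block triangular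
  with square nonempty diagonal blocks; i.e. no nonempty proper index subset I
  such that all entries A(i,j) with i in I, j not in I vanish.\<close>
definition irreducible_mat :: "nat \<Rightarrow> real mat \<Rightarrow> bool" where
  "irreducible_mat n A \<longleftrightarrow> A \<in> carrier_mat n n \<and>
     \<not> (\<exists>I. I \<noteq> {} \<and> I \<subset> {..<n} \<and> (\<forall>i\<in>I. \<forall>j\<in>{..<n} - I. A $$ (i,j) = 0))"

definition real_spectral_radius :: "real mat \<Rightarrow> real" where
  "real_spectral_radius A = spectral_radius (map_mat complex_of_real A)"

definition hadamard_zero :: "real mat \<Rightarrow> real mat \<Rightarrow> bool" where
  "hadamard_zero A C \<longleftrightarrow> (\<forall>i < dim_row A. \<forall>j < dim_col A. A $$ (i,j) * C $$ (i,j) = 0)"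

definition is_splitting :: "nat \<Rightarrow> real mat \<Rightarrow> real mat list \<Rightarrow> bool" where
  "is_splitting n B Bs \<longleftrightarrow> Bs \<noteq> [] \<and>
     (\<forall>X \<in> set Bs. X \<in> carrier_mat n n \<and> X \<noteq> 0\<^sub>m n n) \<and>
     foldr (+) Bs (0\<^sub>m n n) = B \<and>
     (\<forall>p < length Bs. \<forall>q < length Bs. p \<noteq> q \<longrightarrow> hadamard_zero (Bs ! p) (Bs ! q))"

definition block_mat :: "nat \<Rightarrow> nat \<Rightarrow> (nat \<Rightarrow> nat \<Rightarrow> real mat) \<Rightarrow> real mat" where
  "block_mat d n f = mat (d*n) (d*n) (\<lambda>(i,j). f (i div n) (j div n) $$ (i mod n, j mod n))"

definition L_blocks :: "nat \<Rightarrow> real mat list \<Rightarrow> real mat" where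
  "L_blocks n Bs = block_mat (length Bs) n
     (\<lambda>bi bj. if bi > bj then Bs ! bj else 0\<^sub>m n n)"

definition U_blocks :: "nat \<Rightarrow> real mat list \<Rightarrow> real mat" where
  "U_blocks n Bs = block_mat (length Bs) n
     (\<lambda>bi bj. if bi \<le> bj then Bs ! bj else 0\<^sub>m n n)"

definition iteration_mat :: "nat \<Rightarrow> real mat list \<Rightarrow> real mat" where
  "iteration_mat n Bs =
     the (mat_inverse (1\<^sub>m (length Bs * n) - L_blocks n Bs)) * U_blocks n Bs"

definition cyc_shift :: "'a list \<Rightarrow> 'a list" where
  "cyc_shift xs = last xs # butlast xs"

definition refines :: "nat \<Rightarrow> real mat list \<Rightarrow> real mat list \<Rightarrow> bool" where
  "refines n Bs' Bs \<longleftrightarrow> (let d = length Bs in length Bs' = d + 1 \<and>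
     (\<exists>r s. r \<le> d - 1 \<and> s \<le> d \<and>
        (let C = (cyc_shift ^^ r) Bs; C' = (cyc_shift ^^ s) Bs' in
          (\<forall>p < d - 1. C' ! p = C ! p) \<and>
          is_splitting n (C ! (d-1)) [C' ! (d-1), C' ! d] \<and>
          C' ! d * C' ! (d-1) \<noteq> 0\<^sub>m n n)))"

end

theory Submission
  imports Defs
begin

text \<open>
  Since \<open>T = (I - L)\<inverse> U\<close>, the equation \<open>T x = \<lambda> x\<close> is equivalent to \<open>(\<lambda> L + U) x = \<lambda> x\<close>, and because
  \<open>(I - L)\<inverse> \<ge> 0\<close> a nonnegative \<open>y \<noteq> 0\<close> with \<open>(\<lambda> L + U) y \<ge> \<lambda> y\<close> gives \<open>\<rho>(T) \<ge> \<lambda>\<close>. If moreover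
  \<open>(\<lambda> L + U) y - \<lambda> y\<close> dominates a vector \<open>(z,\<dots>,z)\<close> with \<open>0 \<le> z \<noteq> 0\<close>, irreducibility of \<open>B\<^sub>J\<close> makes the
  inequality strict.

  Differences of consecutive block rows of the eigenvalue equation read
  \<open>\<lambda> (x\<^bsub>i+1\<^esub> - x\<^sub>i) = (\<lambda> - 1) B\<^sub>i x\<^sub>i\<close>, and after the last block the recursion returns to \<open>\<lambda> x\<^sub>1\<close>.
  So the blocks are monotone in \<open>i\<close> and lie between \<open>x\<^sub>1\<close> and \<open>\<lambda> x\<^sub>1\<close>, which compares \<open>\<rho>(T)\<close> with \<open>\<rho>(B\<^sub>J)\<close>;
  and the shifted vector \<open>(x\<^sub>d, \<lambda> x\<^sub>1, \<dots>, \<lambda> x\<^bsub>d-1\<^esub>)\<close> is an eigenvector for the cyclically shifted splitting.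

  Let \<open>B\<^sub>d = E + F\<close> with \<open>F E \<noteq> 0\<close> be the refined part. For \<open>\<lambda> < 1\<close>, dropping the last block of a Perron
  vector of the finer splitting gives a subsolution for the coarser one with \<open>z = (1/\<lambda> - 1) F E x\<^sub>d\<close>. For
  \<open>\<lambda> > 1\<close>, appending \<open>x\<^sub>d + (1 - 1/\<lambda>) E x\<^sub>d\<close> to a Perron vector of the coarser splitting gives one for the
  finer splitting with \<open>z = (1 - 1/\<lambda>) F E x\<^sub>d\<close>.
\<close>

section \<open>Perron--Frobenius for nonnegative matrices\<close>

text \<open>Vectors are plain functions read only at indices below \<open>n\<close>, so blocks of a
  long vector and sums over blocks carry no dimension side conditions.\<close>

definition mv :: "nat \<Rightarrow> 'a::semiring_0 mat \<Rightarrow> (nat \<Rightarrow> 'a) \<Rightarrow> nat \<Rightarrow> 'a" where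
  "mv n M x a = (\<Sum>c<n. M $$ (a,c) * x c)"

lemma mult_mat_vec_nth:
  assumes "M \<in> carrier_mat n n" "v \<in> carrier_vec n" "a < n"
  shows "(M *\<^sub>v v) $ a = mv n M (\<lambda>c. v $ c) a"
  using assms by (simp add: mv_def scalar_prod_def atLeast0LessThan)

lemma mv_mult:
  assumes "M \<in> carrier_mat n n" "A \<in> carrier_mat n n" "a < n"
  shows "mv n (M * A) x a = mv n M (mv n A x) a"
proof -
  have "mv n (M * A) x a = (\<Sum>c<n. (\<Sum>b<n. M $$ (a,b) * A $$ (b,c)) * x c)"
    using assms by (simp add: mv_def scalar_prod_def atLeast0LessThan)
  also have "\<dots> = (\<Sum>c<n. \<Sum>b<n. M $$ (a,b) * (A $$ (b,c) * x c))"
    by (simp add: sum_distrib_right mult.assoc)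
  also have "\<dots> = (\<Sum>b<n. \<Sum>c<n. M $$ (a,b) * (A $$ (b,c) * x c))"
    by (rule sum.swap)
  finally show ?thesis by (simp add: mv_def sum_distrib_left)
qed

lemma mv_cong: "(\<And>c. c < n \<Longrightarrow> x c = y c) \<Longrightarrow> mv n M x a = mv n M y a"
  by (simp add: mv_def)

lemma mv_add: "mv n M (\<lambda>c. x c + y c) a = mv n M x a + mv n M y a"
  by (simp add: mv_def sum.distrib distrib_left)

lemma mv_diff: "mv n M (\<lambda>c. x c - y c) a = mv n M x a - (mv n M y a :: 'a::ring)"
  by (simp add: mv_def sum_subtractf right_diff_distrib)

lemma mv_scale: "mv n M (\<lambda>c. k * x c) a = k * (mv n M x a :: 'a::comm_semiring_0)"
  by (simp add: mv_def sum_distrib_left mult.left_commute)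

lemma mv_mono:
  fixes M :: "real mat"
  assumes "M \<in> carrier_mat n n" "nonneg_mat M" "a < n" "\<And>c. c < n \<Longrightarrow> x c \<le> y c"
  shows "mv n M x a \<le> mv n M y a"
  unfolding mv_def using assms by (auto simp: nonneg_mat_def intro!: sum_mono mult_left_mono)

lemma mv_nonneg:
  fixes M :: "real mat"
  assumes "M \<in> carrier_mat n n" "nonneg_mat M" "a < n" "\<And>c. c < n \<Longrightarrow> 0 \<le> x c"
  shows "0 \<le> mv n M x a"
  unfolding mv_def using assms by (auto simp: nonneg_mat_def intro!: sum_nonneg)

lemma mv_entry_le:
  fixes M :: "real mat"
  assumes "M \<in> carrier_mat n n" "nonneg_mat M" "a < n" "c < n" "\<And>c. c < n \<Longrightarrow> 0 \<le> x c"
  shows "M $$ (a,c) * x c \<le> mv n M x a"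
  unfolding mv_def using assms
  by (intro member_le_sum[where f = "\<lambda>c. M $$ (a,c) * x c"]) (auto simp: nonneg_mat_def)

lemma eigenvalue_mvI:
  assumes A: "A \<in> carrier_mat n n"
    and eq: "\<And>a. a < n \<Longrightarrow> mv n A v a = k * v a" and "b < n" "v b \<noteq> 0"
  shows "eigenvalue A (k :: 'a :: field)"
proof -
  have "eigenvector A (vec n v) k"
    unfolding eigenvector_def
  proof (intro conjI)
    show "vec n v \<in> carrier_vec (dim_row A)" using A by simp
    show "vec n v \<noteq> 0\<^sub>v (dim_row A)"
      using A assms(3,4) by (metis carrier_matD(1) index_vec index_zero_vec(1))
    show "A *\<^sub>v vec n v = k \<cdot>\<^sub>v vec n v"
    proof (rule eq_vecI)
      fix a assume "a < dim_vec (k \<cdot>\<^sub>v vec n v)"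
      then have a: "a < n" by simp
      have "(A *\<^sub>v vec n v) $ a = mv n A (\<lambda>c. vec n v $ c) a"
        using A a by (intro mult_mat_vec_nth) auto
      also have "\<dots> = mv n A v a" by (rule mv_cong) simp
      finally show "(A *\<^sub>v vec n v) $ a = (k \<cdot>\<^sub>v vec n v) $ a" using eq[OF a] a by simp
    qed (use A in auto)
  qed
  then show ?thesis unfolding eigenvalue_def by blast
qed

lemma eigenvalue_mvE:
  assumes A: "A \<in> carrier_mat n n" and "eigenvalue A (k :: 'a :: field)"
  obtains v b where "\<And>a. a < n \<Longrightarrow> mv n A v a = k * v a" "b < n" "v b \<noteq> 0"
proof -
  obtain v where v: "v \<in> carrier_vec n" "v \<noteq> 0\<^sub>v n" "A *\<^sub>v v = k \<cdot>\<^sub>v v"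
    using assms unfolding eigenvalue_def eigenvector_def by auto
  then obtain b where b: "b < n" "v $ b \<noteq> 0"
    by (metis carrier_vecD eq_vecI index_zero_vec(1) index_zero_vec(2))
  have "mv n A (\<lambda>c. v $ c) a = k * v $ a" if "a < n" for a
  proof -
    have "mv n A (\<lambda>c. v $ c) a = (k \<cdot>\<^sub>v v) $ a"
      using mult_mat_vec_nth[OF A v(1) that] v(3) by simp
    then show ?thesis using that v(1) by simp
  qed
  then show thesis using b that by blast
qed

section \<open>Growth of powers and subsolutions\<close>

lemma real_spectral_radius_nonneg:
  assumes "A \<in> carrier_mat n n" "n > 0"
  shows "0 \<le> real_spectral_radius A"
  using spectral_radius_mem_max(1)[of "map_mat complex_of_real A" n] assms
  unfolding real_spectral_radius_def by auto

text \<open>Division by \<open>t\<close> moves all eigenvalues strictly inside the unit disc, where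
  the Jordan normal form bounds all powers uniformly.\<close>

lemma power_entries_bound:
  assumes A: "A \<in> carrier_mat n n" and n: "n > 0" and t: "real_spectral_radius A < t"
  obtains C where "\<And>k a c. a < n \<Longrightarrow> c < n \<Longrightarrow> \<bar>(A ^\<^sub>m k) $$ (a,c)\<bar> \<le> C * t ^ k"
proof -
  have t0: "t > 0" using real_spectral_radius_nonneg[OF A n] t by simp
  define cA where "cA = map_mat complex_of_real A"
  define M where "M = complex_of_real (1/t) \<cdot>\<^sub>m cA"
  have cA: "cA \<in> carrier_mat n n" and M: "M \<in> carrier_mat n n"
    using A by (auto simp: cA_def M_def)
  obtain k where k: "eigenvalue M k" "spectral_radius M = cmod k"
    using spectral_radius_mem_max(1)[OF M n] unfolding spectrum_def by auto
  obtain v b where v: "\<And>a. a < n \<Longrightarrow> mv n M v a = k * v a" "b < n" "v b \<noteq> 0"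
    using eigenvalue_mvE[OF M k(1)] by blast
  have "mv n cA v a = (of_real t * k) * v a" if "a < n" for a
  proof -
    have "mv n M v a = of_real (1/t) * mv n cA v a"
      using that cA by (simp add: mv_def M_def sum_distrib_left mult.assoc)
    then have "mv n cA v a = of_real t * mv n M v a" using t0 by simp
    then show ?thesis using v(1)[OF that] by simp
  qed
  from eigenvalue_mvI[OF cA this v(2,3)] have "eigenvalue cA (of_real t * k)" .
  then have "cmod (of_real t * k) \<le> spectral_radius cA"
    by (intro spectral_radius_mem_max(2)[OF cA n]) (simp add: spectrum_def)
  then have "t * cmod k \<le> real_spectral_radius A" using t0
    by (simp add: norm_mult cA_def real_spectral_radius_def)
  then have "t * cmod k < t * 1" using t by simp
  then have "cmod k < 1" using t0 mult_less_cancel_left_pos by blast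
  then have "spectral_radius M < 1" using k(2) by simp
  then obtain C where C: "\<And>k. norm_bound (M ^\<^sub>m k) C"
    using spectral_radius_jnf_norm_bound_less_1_upper_triangular[OF M] by blast
  have pw: "(M ^\<^sub>m k) = of_real ((1/t) ^ k) \<cdot>\<^sub>m map_mat complex_of_real (A ^\<^sub>m k)" for k
  proof (induction k)
    case 0 show ?case using A M by (auto intro!: eq_matI)
  next
    case (Suc k)
    have "M ^\<^sub>m Suc k = (of_real ((1/t) ^ k) \<cdot>\<^sub>m map_mat complex_of_real (A ^\<^sub>m k)) * M"
      using Suc by simp
    also have "\<dots> = of_real ((1/t) ^ Suc k) \<cdot>\<^sub>m (map_mat complex_of_real (A ^\<^sub>m k) * cA)"
      unfolding M_def using A cA
      by (auto simp: mult_smult_assoc_mat[where n = n and nr = n] mult_smult_distrib[where n = n and nr = n and nc = n] intro!: eq_matI)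
    also have "map_mat complex_of_real (A ^\<^sub>m k) * cA = map_mat complex_of_real (A ^\<^sub>m Suc k)"
      unfolding cA_def using A by (simp add: of_real_hom.mat_hom_mult[of "A ^\<^sub>m k" n n A n])
    finally show ?case .
  qed
  have "\<bar>(A ^\<^sub>m k) $$ (a,c)\<bar> \<le> C * t ^ k" if "a < n" "c < n" for k a c
  proof -
    have "cmod ((M ^\<^sub>m k) $$ (a,c)) \<le> C" using C[of k] M that by (auto simp: norm_bound_def)
    then have "(1/t) ^ k * \<bar>(A ^\<^sub>m k) $$ (a,c)\<bar> \<le> C"
      using A that t0 by (simp add: pw norm_mult norm_power norm_divide)
    then show ?thesis using t0 by (simp add: field_simps)
  qed
  then show thesis using that by blast
qed

lemma funpow_mv:
  assumes A: "A \<in> carrier_mat n n" and "a < n"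
  shows "(mv n A ^^ k) x a = mv n (A ^\<^sub>m k) x (a::nat)"
  using \<open>a < n\<close>
proof (induction k arbitrary: x)
  case 0
  have "mv n (1\<^sub>m n) x a = (\<Sum>c<n. if c = a then x c else 0)"
    unfolding mv_def using 0 by (intro sum.cong) auto
  then show ?case using A 0 by simp
next
  case (Suc k)
  then show ?case using mv_mult[of "A ^\<^sub>m k" n A a x] A
    by (simp add: funpow_swap1)
qed

text \<open>Lower Collatz-Wielandt bound. Iteration gives \<open>s^k x <= A^k x\<close>; if
  \<open>rho < t < s\<close>, the entries of \<open>A^k\<close> grow at most like
  \<open>t^k\<close>, which is too slow at the index \<open>b\<close>.\<close>

lemma subsolution_le_spectral_radius:
  assumes A: "A \<in> carrier_mat n n" "nonneg_mat A"
    and x: "\<And>a. a < n \<Longrightarrow> 0 \<le> x a" "b < n" "0 < x b"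
    and sub: "\<And>a. a < n \<Longrightarrow> s * x a \<le> mv n A x a"
  shows "s \<le> real_spectral_radius A"
proof (rule ccontr)
  assume "\<not> ?thesis"
  then obtain t where t: "real_spectral_radius A < t" "t < s" using dense not_le by metis
  have n: "n > 0" using x by auto
  have t0: "t > 0" using real_spectral_radius_nonneg[OF A(1) n] t by simp
  obtain C where C: "\<And>k a c. a < n \<Longrightarrow> c < n \<Longrightarrow> \<bar>(A ^\<^sub>m k) $$ (a,c)\<bar> \<le> C * t ^ k"
    using power_entries_bound[OF A(1) n t(1)] by blast
  have it: "a < n \<Longrightarrow> s ^ k * x a \<le> (mv n A ^^ k) x a" for k a
  proof (induction k arbitrary: a)
    case (Suc k)
    have "s ^ Suc k * x a \<le> s ^ k * mv n A x a"
      using sub[OF Suc.prems] t t0 by (simp add: mult.commute mult_left_mono mult.left_commute)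
    also have "\<dots> = mv n A (\<lambda>c. s ^ k * x c) a" by (simp add: mv_scale)
    also have "\<dots> \<le> mv n A ((mv n A ^^ k) x) a"
      using Suc by (intro mv_mono[OF A]) auto
    finally show ?case by simp
  qed simp
  define D where "D = C * (\<Sum>c<n. x c)"
  have bd: "(s/t) ^ k * x b \<le> D" for k
  proof -
    have "s ^ k * x b \<le> mv n (A ^\<^sub>m k) x b" using it[OF x(2)] funpow_mv[OF A(1) x(2)] by simp
    also have "\<dots> \<le> (\<Sum>c<n. (C * t ^ k) * x c)"
      unfolding mv_def using C[OF x(2)] x(1)
      by (intro sum_mono mult_right_mono) (auto intro: order_trans[OF abs_ge_self])
    also have "\<dots> = D * t ^ k" unfolding D_def by (simp add: sum_distrib_left mult_ac)
    finally show ?thesis using t0 by (simp add: power_divide field_simps)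
  qed
  have "1 < s / t" using t t0 by simp
  from real_arch_pow[OF this, of "D / x b"] obtain k where "D / x b < (s/t) ^ k" by blast
  then have "D < (s/t) ^ k * x b" using x(3) by (simp add: field_simps)
  with bd[of k] show False by simp
qed

text \<open>The negative part of \<open>u\<close> is a subsolution at level \<open>t\<close>.\<close>
lemma M_matrix_monotone:
  assumes A: "A \<in> carrier_mat n n" "nonneg_mat A" and t: "real_spectral_radius A < t"
    and u: "\<And>a. a < n \<Longrightarrow> mv n A u a \<le> t * u a" and a: "a < n"
  shows "0 \<le> u a"
proof (rule ccontr)
  assume neg: "\<not> ?thesis"
  have t0: "t > 0" using real_spectral_radius_nonneg[OF A(1)] t a by fastforce
  define w where "w = (\<lambda>c. max (- u c) 0)"
  have "t \<le> real_spectral_radius A"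
  proof (rule subsolution_le_spectral_radius[OF A _ a])
    show "0 \<le> w c" for c by (simp add: w_def)
    show "0 < w a" using neg by (simp add: w_def)
    fix c assume c: "c < n"
    have "mv n A (\<lambda>c. (-1) * u c) c \<le> mv n A w c"
      by (intro mv_mono[OF A c]) (auto simp: w_def)
    then have "t * (- u c) \<le> mv n A w c"
      using u[OF c] mv_scale[of n A "-1" u c] by simp
    moreover have "0 \<le> mv n A w c" by (intro mv_nonneg[OF A c]) (auto simp: w_def)
    ultimately show "t * w c \<le> mv n A w c" by (auto simp: w_def max_def)
  qed
  with t show False by simp
qed

text \<open>\<open>t I - A\<close> is nonsingular: the moduli of a nonzero kernel vector would form
  a subsolution at level \<open>t\<close>, above the spectral radius.\<close>

lemma resolvent_solvable:
  assumes A: "A \<in> carrier_mat n n" "nonneg_mat A" and t: "real_spectral_radius A < t" and n: "n > 0"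
  obtains u where "\<And>a. a < n \<Longrightarrow> t * u a = mv n A u a + w a"
proof -
  have t0: "t > 0" using real_spectral_radius_nonneg[OF A(1) n] t by simp
  define M where "M = t \<cdot>\<^sub>m 1\<^sub>m n - A"
  have M: "M \<in> carrier_mat n n" using A unfolding M_def by (intro minus_carrier_mat)
  have Mx: "mv n M x a = t * x a - mv n A x a" if a: "a < n" for x a
  proof -
    have "mv n M x a = (\<Sum>c<n. (if c = a then t * x c else 0) - A $$ (a,c) * x c)"
      unfolding mv_def M_def using A a by (intro sum.cong) (auto simp: algebra_simps)
    also have "\<dots> = t * x a - mv n A x a" using a by (simp add: sum_subtractf mv_def)
    finally show ?thesis .
  qed
  have "det M \<noteq> 0"
  proof
    assume "det M = 0"
    then obtain v where v: "v \<in> carrier_vec n" "v \<noteq> 0\<^sub>v n" "M *\<^sub>v v = 0\<^sub>v n"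
      using det_0_iff_vec_prod_zero[OF M] by auto
    then obtain b where b: "b < n" "v $ b \<noteq> 0"
      by (metis carrier_vecD eq_vecI index_zero_vec(1) index_zero_vec(2))
    have Av: "t * v $ a = mv n A (\<lambda>c. v $ c) a" if "a < n" for a
      using mult_mat_vec_nth[OF M v(1) that] v(3) Mx[OF that] that by simp
    have "t \<le> real_spectral_radius A"
    proof (rule subsolution_le_spectral_radius[OF A, of "\<lambda>c. \<bar>v $ c\<bar>" b])
      fix a assume a: "a < n"
      have "t * \<bar>v $ a\<bar> = \<bar>mv n A (\<lambda>c. v $ c) a\<bar>"
        using t0 by (simp flip: Av[OF a] add: abs_mult)
      also have "\<dots> \<le> (\<Sum>c<n. \<bar>A $$ (a,c) * v $ c\<bar>)" unfolding mv_def by (rule sum_abs)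
      also have "\<dots> = mv n A (\<lambda>c. \<bar>v $ c\<bar>) a"
        unfolding mv_def using A a by (intro sum.cong) (auto simp: nonneg_mat_def abs_mult)
      finally show "t * \<bar>v $ a\<bar> \<le> mv n A (\<lambda>c. \<bar>v $ c\<bar>) a" .
    qed (use b in auto)
    with t show False by simp
  qed
  from det_non_zero_imp_unit[OF M this] obtain B where B: "M * B = 1\<^sub>m n" "B \<in> carrier_mat n n"
    unfolding Units_def ring_mat_def by auto
  show thesis
  proof
    fix a assume a: "a < n"
    have "mv n M (mv n B w) a = mv n (1\<^sub>m n) w a" using mv_mult[OF M B(2) a] B(1) by simp
    also have "\<dots> = (\<Sum>c<n. if c = a then w c else 0)"
      unfolding mv_def using a by (intro sum.cong) auto
    finally have "mv n M (mv n B w) a = w a" using a by simp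
    then show "t * mv n B w a = mv n A (mv n B w) a + w a" using Mx[OF a] by simp
  qed
qed

text \<open>Bolzano-Weierstrass, one coordinate at a time: each new coordinate has a monotone
  subsequence, and passing to it keeps the earlier limits.\<close>

lemma pointwise_convergent_subsequence:
  fixes f :: "nat \<Rightarrow> nat \<Rightarrow> real"
  assumes "\<And>k a. a < n \<Longrightarrow> \<bar>f k a\<bar> \<le> K"
  obtains r where "strict_mono r" "\<And>a. a < n \<Longrightarrow> convergent (\<lambda>k. f (r k) a)"
proof -
  have "\<exists>r. strict_mono r \<and> (\<forall>a<n. convergent (\<lambda>k. f (r k) a))" using assms
  proof (induction n)
    case 0 show ?case using strict_mono_id by blast
  next
    case (Suc n)
    then obtain r where r: "strict_mono r" "\<And>a. a < n \<Longrightarrow> convergent (\<lambda>k. f (r k) a)" by auto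
    obtain g where g: "strict_mono g" "monoseq (\<lambda>k. f (r (g k)) n)"
      using seq_monosub[of "\<lambda>k. f (r k) n"] by auto
    have "Bseq (\<lambda>k. f (r (g k)) n)" using Suc.prems[of n] by (intro BseqI'[of _ K]) simp
    then have "convergent (\<lambda>k. f (r (g k)) n)" using g(2) Bseq_monoseq_convergent by blast
    moreover have "convergent (\<lambda>k. f (r (g k)) a)" if "a < n" for a
      using convergent_subseq_convergent[OF r(2)[OF that] g(1)] by (simp add: o_def)
    ultimately show ?case using r(1) g(1)
      by (intro exI[of _ "r \<circ> g"] conjI strict_mono_o) (auto simp: less_Suc_eq)
  qed
  then show thesis using that by blast
qed

text \<open>With \<open>w\<close> the modulus of an eigenvector for a peripheral eigenvalue, the solution \<open>u\<close> of
  \<open>t u = A u + w\<close> satisfies \<open>w \<le> (t - \<rho>) u\<close>; so after normalisation of \<open>u\<close> the inhomogeneity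
  disappears as \<open>t\<close> decreases to \<open>\<rho>\<close>.\<close>
lemma nonneg_mat_Perron_vector:
  assumes A: "A \<in> carrier_mat n n" "nonneg_mat A" and n: "n > 0"
  obtains x b where "\<And>a. a < n \<Longrightarrow> 0 \<le> x a" "b < n" "0 < x b"
    "\<And>a. a < n \<Longrightarrow> mv n A x a = real_spectral_radius A * x a"
proof -
  define R where "R = real_spectral_radius A"
  define cA where "cA = map_mat complex_of_real A"
  have cA: "cA \<in> carrier_mat n n" using A by (simp add: cA_def)
  obtain k where k: "eigenvalue cA k" "R = cmod k"
    using spectral_radius_mem_max(1)[OF cA n]
    unfolding spectrum_def R_def real_spectral_radius_def cA_def by auto
  obtain v b where v: "\<And>a. a < n \<Longrightarrow> mv n cA v a = k * v a" "b < n" "v b \<noteq> 0"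
    using eigenvalue_mvE[OF cA k(1)] by blast
  define w where "w = (\<lambda>a. cmod (v a))"
  have Rw: "R * w a \<le> mv n A w a" if a: "a < n" for a
  proof -
    have "R * w a = cmod (mv n cA v a)" using v(1)[OF a] k(2) by (simp add: w_def norm_mult)
    also have "\<dots> \<le> (\<Sum>c<n. cmod (cA $$ (a,c) * v c))" unfolding mv_def by (rule norm_sum)
    also have "\<dots> = mv n A w a" unfolding mv_def w_def cA_def
      using A a by (intro sum.cong) (auto simp: nonneg_mat_def norm_mult)
    finally show ?thesis .
  qed
  have ex: "\<exists>z. (\<forall>a<n. 0 \<le> z a) \<and> (\<Sum>a<n. z a) = 1 \<and>
      (\<forall>a<n. \<bar>mv n A z a - R * z a\<bar> \<le> 1 / Suc m)" for m
  proof -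
    define t where "t = R + 1 / Suc m"
    have t: "R < t" by (simp add: t_def)
    obtain u where u: "\<And>a. a < n \<Longrightarrow> t * u a = mv n A u a + w a"
      using resolvent_solvable[OF A t[unfolded R_def] n] by blast
    have u0: "0 \<le> u a" if "a < n" for a
      using M_matrix_monotone[OF A t[unfolded R_def], of u a] u that by (simp add: w_def)
    have uw: "w a \<le> (t - R) * u a" if a: "a < n" for a
    proof -
      have "0 \<le> (t - R) * u a - w a"
      proof (rule M_matrix_monotone[OF A t[unfolded R_def] _ a])
        fix c assume c: "c < n"
        \<comment> \<open>Applying \<open>t I - A\<close> to \<open>(t - R) u - w\<close> leaves
          \<open>A w - R w\<close>, which is nonnegative by \<open>Rw\<close>.\<close>
        have "t * ((t - R) * u c - w c) - mv n A (\<lambda>c. (t - R) * u c - w c) c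
          = (t - R) * (t * u c - mv n A u c) - (t * w c - mv n A w c)"
          unfolding mv_diff mv_scale by (simp add: algebra_simps)
        also have "\<dots> = mv n A w c - R * w c" using u[OF c] by (simp add: algebra_simps)
        finally show "mv n A (\<lambda>c. (t - R) * u c - w c) c \<le> t * ((t - R) * u c - w c)"
          using Rw[OF c] by simp
      qed
      then show ?thesis by simp
    qed
    define S where "S = (\<Sum>a<n. u a)"
    have uS: "u a \<le> S" if "a < n" for a
      unfolding S_def using that u0 by (intro member_le_sum) auto
    have "0 < u b" using uw[OF v(2)] t v(3) u0[OF v(2)]
      by (metis less_eq_real_def mult_zero_right not_less w_def zero_less_norm_iff)
    then have S: "S > 0" using uS[OF v(2)] by simp
    define z where "z = (\<lambda>a. (1 / S) * u a)"
    have "\<bar>mv n A z a - R * z a\<bar> \<le> 1 / Suc m" if a: "a < n" for a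
    proof -
      have e: "mv n A z a - R * z a = ((t - R) * u a - w a) / S"
        unfolding z_def mv_scale using u[OF a] S by (simp add: field_simps)
      have "0 \<le> ((t - R) * u a - w a) / S" using uw[OF a] S by simp
      moreover
      have "(t - R) * u a - w a \<le> (t - R) * S"
      proof -
        have "(t - R) * u a \<le> (t - R) * S" using uS[OF a] t by (intro mult_left_mono) auto
        then show ?thesis using norm_ge_zero[of "v a"] unfolding w_def by linarith
      qed
      then have "((t - R) * u a - w a) / S \<le> t - R" using S by (simp add: divide_le_eq)
      ultimately show ?thesis unfolding e by (simp add: t_def)
    qed
    moreover have "(\<Sum>a<n. z a) = 1" using S by (simp add: z_def S_def flip: sum_divide_distrib)
    ultimately show ?thesis using u0 S by (intro exI[of _ z]) (auto simp: z_def)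
  qed
  then obtain z where z: "\<And>m a. a < n \<Longrightarrow> 0 \<le> z m a" "\<And>m. (\<Sum>a<n. z m a) = 1"
    "\<And>m a. a < n \<Longrightarrow> \<bar>mv n A (z m) a - R * z m a\<bar> \<le> 1 / Suc m" by metis
  have "\<bar>z m a\<bar> \<le> 1" if "a < n" for m a
    using member_le_sum[of a "{..<n}" "z m"] z(1,2) that by simp
  then obtain r where r: "strict_mono r" "\<And>a. a < n \<Longrightarrow> convergent (\<lambda>m. z (r m) a)"
    using pointwise_convergent_subsequence[of n z 1] by blast
  define x where "x = (\<lambda>a. lim (\<lambda>m. z (r m) a))"
  have lim: "(\<lambda>m. z (r m) a) \<longlonglongrightarrow> x a" if "a < n" for a
    using r(2)[OF that] by (simp add: x_def convergent_LIMSEQ_iff)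
  have x0: "0 \<le> x a" if "a < n" for a
    using LIMSEQ_le_const[OF lim[OF that]] z(1)[OF that] by blast
  \<comment> \<open>The normalisation survives the limit, so \<open>x\<close> cannot vanish.\<close>
  have "(\<lambda>m. \<Sum>a<n. z (r m) a) \<longlonglongrightarrow> (\<Sum>a<n. x a)" by (intro tendsto_sum lim) simp
  then have sum1: "(\<Sum>a<n. x a) = 1" using z(2) by (simp add: LIMSEQ_const_iff)
  have "\<exists>b<n. 0 < x b"
  proof (rule ccontr)
    assume "\<not> ?thesis"
    then have "(\<Sum>a<n. x a) = 0" using x0 by (intro sum.neutral) (metis lessThan_iff order_le_less)
    with sum1 show False by simp
  qed
  then obtain b' where b': "b' < n" "0 < x b'" by blast
  have "mv n A x a = R * x a" if a: "a < n" for a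
  proof -
    have l1: "(\<lambda>m. mv n A (z (r m)) a - R * z (r m) a) \<longlonglongrightarrow> mv n A x a - R * x a"
      unfolding mv_def by (intro tendsto_intros lim) (use a in auto)
    have "(\<lambda>m. 1 / real (Suc (r m))) \<longlonglongrightarrow> 0"
      using LIMSEQ_subseq_LIMSEQ[OF lim_1_over_n r(1)]
        LIMSEQ_subseq_LIMSEQ[OF LIMSEQ_inverse_real_of_nat r(1)]
      by (simp add: o_def inverse_eq_divide)
    then have "(\<lambda>m. mv n A (z (r m)) a - R * z (r m) a) \<longlonglongrightarrow> 0"
      by (rule tendsto_0_le[of _ _ _ 1]) (use z(3)[OF a] in auto)
    from LIMSEQ_unique[OF l1 this] show ?thesis by simp
  qed
  then show thesis using that[of x b'] x0 b' by (auto simp: R_def)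
qed

section \<open>The iteration matrix in block form\<close>

text \<open>Block row \<open>i\<close> of \<open>l L + U\<close>. Blocks are counted from 0, so
  \<open>x 0\<close> is the first block and row 0 carries no factor \<open>l\<close>.\<close>

definition sweep :: "nat \<Rightarrow> real mat list \<Rightarrow> real \<Rightarrow> (nat \<Rightarrow> nat \<Rightarrow> real) \<Rightarrow> nat \<Rightarrow> nat \<Rightarrow> real" where
  "sweep n Bs l x i a =
     l * (\<Sum>j<i. mv n (Bs ! j) (x j) a) + (\<Sum>j=i..<length Bs. mv n (Bs ! j) (x j) a)"

text \<open>The form in which splittings of a nonnegative matrix enter all estimates;
  \<open>nonneg_parts_of_splitting\<close> derives the signs from the disjoint supports. The
  entrywise sum makes invariance under cyclic shifts immediate.\<close>

definition nonneg_parts :: "nat \<Rightarrow> real mat \<Rightarrow> real mat list \<Rightarrow> bool" where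
  "nonneg_parts n A Bs \<longleftrightarrow> Bs \<noteq> [] \<and>
     (\<forall>X \<in> set Bs. X \<in> carrier_mat n n \<and> nonneg_mat X \<and> X \<noteq> 0\<^sub>m n n) \<and>
     (\<forall>a<n. \<forall>c<n. (\<Sum>X\<leftarrow>Bs. X $$ (a,c)) = A $$ (a,c))"

lemma nonneg_parts_nth:
  assumes "nonneg_parts n A Bs" "j < length Bs"
  shows "Bs ! j \<in> carrier_mat n n" "nonneg_mat (Bs ! j)" "Bs ! j \<noteq> 0\<^sub>m n n"
  using assms by (auto simp: nonneg_parts_def)

lemma sum_mv_parts:
  assumes "nonneg_parts n A Bs" "a < n"
  shows "(\<Sum>j<length Bs. mv n (Bs ! j) z a) = mv n A z a"
proof -
  have "(\<Sum>j<length Bs. mv n (Bs ! j) z a) = (\<Sum>c<n. \<Sum>j<length Bs. (Bs ! j) $$ (a,c) * z c)"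
    unfolding mv_def by (rule sum.swap)
  also have "\<dots> = (\<Sum>c<n. (\<Sum>X\<leftarrow>Bs. X $$ (a,c)) * z c)"
    by (simp add: sum_list_sum_nth atLeast0LessThan sum_distrib_right)
  also have "\<dots> = mv n A z a" unfolding mv_def using assms by (simp add: nonneg_parts_def)
  finally show ?thesis .
qed

lemma nonzero_nonneg_entry:
  assumes "X \<in> carrier_mat n n" "nonneg_mat X" "X \<noteq> 0\<^sub>m n n"
  obtains a c where "a < n" "c < n" "0 < X $$ (a,c)"
proof -
  have "\<exists>a<n. \<exists>c<n. X $$ (a,c) \<noteq> 0"
    using assms(1,3) by (auto intro!: eq_matI)
  then show thesis using that assms(1,2) by (fastforce simp: nonneg_mat_def order.order_iff_strict)
qed

lemma sum_blocks: "(\<Sum>q<d*n. f q) = (\<Sum>j<d. \<Sum>c<n. f (j*n+c :: nat))"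
proof -
  have "(\<Sum>c<n. f (j*n+c)) = (\<Sum>q=j*n..<j*n+n. f q)" for j
    using sum.shift_bounds_nat_ivl[of f 0 "j*n" n] by (simp add: atLeast0LessThan add.commute)
  then show ?thesis using sum.nat_group[of f n d] by simp
qed

lemma block_index_less: "i < d \<Longrightarrow> a < n \<Longrightarrow> i*n+a < d*(n::nat)"
  using mult_le_mono1[of "Suc i" d n] by simp

lemma block_index_cases:
  assumes "p < d*n"
  obtains i a where "i < d" "a < n" "p = i*n+(a::nat)"
proof
  have n: "n > 0" using assms by (cases n) auto
  show "p div n < d" using assms by (simp add: less_mult_imp_div_less)
  show "p mod n < n" using n by simp
  show "p = p div n * n + p mod n" by simp
qed

lemma mv_block_mat:
  assumes "i < d" "a < n"
  shows "mv (d*n) (block_mat d n F) v (i*n+a) = (\<Sum>j<d. mv n (F i j) (\<lambda>c. v (j*n+c)) a)"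
  unfolding mv_def sum_blocks block_mat_def
  using assms by (intro sum.cong refl) (simp add: block_index_less)

lemma mv_zero_mat: "a < n \<Longrightarrow> mv n (0\<^sub>m n n) x a = 0"
  by (simp add: mv_def)

lemma mv_L_blocks:
  assumes "i < length Bs" "a < n"
  shows "mv (length Bs * n) (L_blocks n Bs) v (i*n+a) = (\<Sum>j<i. mv n (Bs ! j) (\<lambda>c. v (j*n+c)) a)"
proof -
  have "mv (length Bs * n) (L_blocks n Bs) v (i*n+a)
    = (\<Sum>j<length Bs. if j < i then mv n (Bs ! j) (\<lambda>c. v (j*n+c)) a else 0)"
    unfolding L_blocks_def mv_block_mat[OF assms]
    using assms by (intro sum.cong) (auto simp: mv_zero_mat)
  also have "\<dots> = (\<Sum>j\<in>{..<length Bs} \<inter> {j. j < i}. mv n (Bs ! j) (\<lambda>c. v (j*n+c)) a)"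
    by (simp add: sum.If_cases)
  also have "{..<length Bs} \<inter> {j. j < i} = {..<i}" using assms by auto
  finally show ?thesis .
qed

lemma mv_U_blocks:
  assumes "i < length Bs" "a < n"
  shows "mv (length Bs * n) (U_blocks n Bs) v (i*n+a)
    = (\<Sum>j=i..<length Bs. mv n (Bs ! j) (\<lambda>c. v (j*n+c)) a)"
proof -
  have "mv (length Bs * n) (U_blocks n Bs) v (i*n+a)
    = (\<Sum>j<length Bs. if i \<le> j then mv n (Bs ! j) (\<lambda>c. v (j*n+c)) a else 0)"
    unfolding U_blocks_def mv_block_mat[OF assms]
    using assms by (intro sum.cong) (auto simp: mv_zero_mat)
  also have "\<dots> = (\<Sum>j\<in>{..<length Bs} \<inter> {j. i \<le> j}. mv n (Bs ! j) (\<lambda>c. v (j*n+c)) a)"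
    by (simp add: sum.If_cases)
  also have "{..<length Bs} \<inter> {j. i \<le> j} = {i..<length Bs}" using assms by auto
  finally show ?thesis .
qed

lemma sweep_blocks:
  assumes "i < length Bs" "a < n"
  shows "sweep n Bs l (\<lambda>i c. v (i*n+c)) i a
    = l * mv (length Bs * n) (L_blocks n Bs) v (i*n+a) + mv (length Bs * n) (U_blocks n Bs) v (i*n+a)"
  by (simp add: sweep_def mv_L_blocks[OF assms] mv_U_blocks[OF assms])

section \<open>Triangular structure of I - L and nonnegativity of T\<close>

lemma L_blocks_carrier: "L_blocks n Bs \<in> carrier_mat (length Bs * n) (length Bs * n)"
  and U_blocks_carrier: "U_blocks n Bs \<in> carrier_mat (length Bs * n) (length Bs * n)"
  by (auto simp: L_blocks_def U_blocks_def block_mat_def)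

lemma L_blocks_strictly_lower:
  assumes "p \<le> q" "q < length Bs * n"
  shows "L_blocks n Bs $$ (p,q) = 0"
proof -
  have n: "n > 0" using assms by (cases n) auto
  have "\<not> q div n < p div n" using div_le_mono[OF assms(1), of n] by simp
  then show ?thesis using assms n by (simp add: L_blocks_def block_mat_def)
qed

lemma blocks_nonneg:
  assumes "nonneg_parts n A Bs"
  shows "nonneg_mat (L_blocks n Bs)" "nonneg_mat (U_blocks n Bs)"
proof -
  have "0 \<le> (Bs ! j) $$ (a,c)" if "j < length Bs" "a < n" "c < n" for j a c
    using nonneg_parts_nth[OF assms that(1)] that by (auto simp: nonneg_mat_def)
  moreover have "q div n < length Bs" "p mod n < n" if "q < length Bs * n" for p q
    using that by (cases n; simp add: less_mult_imp_div_less)+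
  ultimately show "nonneg_mat (L_blocks n Bs)" "nonneg_mat (U_blocks n Bs)"
    unfolding nonneg_mat_def L_blocks_def U_blocks_def block_mat_def by auto
qed

text \<open>Nonnegativity of the inverse of \<open>I - L\<close>, as forward substitution: row
  \<open>p\<close> of \<open>L w\<close> involves only entries of \<open>w\<close> before
  \<open>p\<close>.\<close>

lemma L_blocks_monotone:
  assumes parts: "nonneg_parts n A Bs" and "p < length Bs * n"
    and w: "\<And>p. p < length Bs * n \<Longrightarrow> mv (length Bs * n) (L_blocks n Bs) w p \<le> w p"
  shows "0 \<le> w p"
  using \<open>p < length Bs * n\<close>
proof (induction p rule: less_induct)
  case (less p)
  have "0 \<le> L_blocks n Bs $$ (p,q) * w q" if q: "q < length Bs * n" for q
  proof (cases "q < p")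
    case True
    then show ?thesis using less q blocks_nonneg(1)[OF parts] L_blocks_carrier[of n Bs]
      by (auto simp: nonneg_mat_def)
  qed (use q L_blocks_strictly_lower in auto)
  then have "0 \<le> mv (length Bs * n) (L_blocks n Bs) w p"
    unfolding mv_def by (intro sum_nonneg) auto
  with w[OF less.prems] show ?case by simp
qed

text \<open>\<open>I - L\<close> is unit lower triangular, so \<open>mat_inverse\<close> does return
  an inverse. From here on \<open>T\<close> is used only through
  \<open>(I - L) T = U\<close>.\<close>

lemma iteration_mat_eq:
  "iteration_mat n Bs \<in> carrier_mat (length Bs * n) (length Bs * n)" (is ?carrier)
  "(1\<^sub>m (length Bs * n) - L_blocks n Bs) * iteration_mat n Bs = U_blocks n Bs" (is ?eq)
proof -
  define N where "N = length Bs * n"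
  define M where "M = 1\<^sub>m N - L_blocks n Bs"
  note L = L_blocks_carrier[of n Bs, folded N_def] and U = U_blocks_carrier[of n Bs, folded N_def]
  have M: "M \<in> carrier_mat N N" unfolding M_def using L by (intro minus_carrier_mat)
  have ent: "M $$ (p,q) = (if p = q then 1 else 0)" if "p \<le> q" "q < N" for p q
    using that L L_blocks_strictly_lower[of p q Bs n, folded N_def] by (auto simp: M_def)
  have "det M = prod_list (diag_mat M)" using ent by (intro det_lower_triangular[OF _ M]) auto
  also have "diag_mat M = replicate N 1"
    using M ent by (auto simp: diag_mat_def intro!: nth_equalityI)
  finally have "det M \<noteq> 0" by simp
  from det_non_zero_imp_unit[OF M this, of "()"] obtain W where W: "mat_inverse M = Some W"
    using mat_inverse(1)[OF M, of "()"] by (cases "mat_inverse M") auto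
  note inv = mat_inverse(2)[OF M W]
  have T: "iteration_mat n Bs = W * U_blocks n Bs"
    using W by (simp add: iteration_mat_def M_def N_def)
  show ?carrier using inv U by (auto simp: T simp flip: N_def)
  have "M * (W * U_blocks n Bs) = (M * W) * U_blocks n Bs"
    using M inv U by (metis assoc_mult_mat)
  then show ?eq using inv U by (simp add: T M_def N_def)
qed

lemma iteration_mat_fixpoint:
  assumes p: "p < length Bs * n"
  shows "mv (length Bs * n) (iteration_mat n Bs) v p
    = mv (length Bs * n) (L_blocks n Bs) (mv (length Bs * n) (iteration_mat n Bs) v) p
      + mv (length Bs * n) (U_blocks n Bs) v p"
proof -
  define N where "N = length Bs * n"
  define w where "w = mv N (iteration_mat n Bs) v"
  note L = L_blocks_carrier[of n Bs, folded N_def] and it = iteration_mat_eq[where n = n and Bs = Bs, folded N_def]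
  have M: "1\<^sub>m N - L_blocks n Bs \<in> carrier_mat N N" using L by (intro minus_carrier_mat)
  have "mv N (U_blocks n Bs) v p = mv N (1\<^sub>m N - L_blocks n Bs) w p"
    using mv_mult[OF M it(1) p[folded N_def], of v] it(2) by (simp add: w_def)
  also have "\<dots> = (\<Sum>q<N. (if q = p then w q else 0) - L_blocks n Bs $$ (p,q) * w q)"
    unfolding mv_def using L p by (intro sum.cong) (auto simp: algebra_simps N_def)
  also have "\<dots> = w p - mv N (L_blocks n Bs) w p"
    using p by (simp add: sum_subtractf mv_def N_def)
  finally show ?thesis by (simp add: w_def N_def)
qed

text \<open>For a unit vector \<open>e\<close>, \<open>T e\<close> is a column of \<open>T\<close>,
  and \<open>(I - L) (T e) = U e\<close> is nonnegative, so \<open>L_blocks_monotone\<close>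
  applies.\<close>

lemma iteration_mat_nonneg:
  assumes parts: "nonneg_parts n A Bs"
  shows "nonneg_mat (iteration_mat n Bs)"
  unfolding nonneg_mat_def
proof (intro allI impI)
  define N where "N = length Bs * n"
  note T = iteration_mat_eq(1)[of n Bs, folded N_def]
  fix p q assume "p < dim_row (iteration_mat n Bs)" "q < dim_col (iteration_mat n Bs)"
  then have p: "p < N" and q: "q < N" using T by auto
  define e :: "nat \<Rightarrow> real" where "e = (\<lambda>r. if r = q then 1 else 0)"
  have "mv N (iteration_mat n Bs) e p = (\<Sum>r<N. if r = q then iteration_mat n Bs $$ (p,r) else 0)"
    unfolding mv_def e_def by (intro sum.cong) auto
  moreover have "0 \<le> mv N (iteration_mat n Bs) e p"
    unfolding N_def
  proof (rule L_blocks_monotone[OF parts p[unfolded N_def]])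
    fix p assume p: "p < length Bs * n"
    have "0 \<le> mv (length Bs * n) (U_blocks n Bs) e p"
      by (intro mv_nonneg[OF U_blocks_carrier blocks_nonneg(2)[OF parts] p]) (simp add: e_def)
    then show "mv (length Bs * n) (L_blocks n Bs) (mv (length Bs * n) (iteration_mat n Bs) e) p
      \<le> mv (length Bs * n) (iteration_mat n Bs) e p"
      using iteration_mat_fixpoint[OF p, of e] by simp
  qed
  ultimately show "0 \<le> iteration_mat n Bs $$ (p,q)" using q by simp
qed

section \<open>Spectral radius of T in terms of block rows\<close>

abbreviation rho_it :: "nat \<Rightarrow> real mat list \<Rightarrow> real" where
  "rho_it n Bs \<equiv> real_spectral_radius (iteration_mat n Bs)"

text \<open>Substituting \<open>T v = rho v\<close> on both sides of
  \<open>T v = L (T v) + U v\<close> turns a Perron vector of \<open>T\<close> into an eigenvector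
  of the sweep.\<close>

lemma iteration_Perron_vector:
  assumes parts: "nonneg_parts n A Bs" and n: "n > 0"
  obtains x k b where "\<And>i a. i < length Bs \<Longrightarrow> a < n \<Longrightarrow> 0 \<le> x i a"
    "k < length Bs" "b < n" "0 < x k b"
    "\<And>i a. i < length Bs \<Longrightarrow> a < n \<Longrightarrow> sweep n Bs (rho_it n Bs) x i a = rho_it n Bs * x i a"
proof -
  define N where "N = length Bs * n"
  note T = iteration_mat_eq(1)[of n Bs, folded N_def]
  have "N > 0" using parts n by (simp add: N_def nonneg_parts_def)
  from nonneg_mat_Perron_vector[OF T iteration_mat_nonneg[OF parts] this]
  obtain v p where v: "\<And>p. p < N \<Longrightarrow> 0 \<le> v p" "p < N" "0 < v p"
    "\<And>p. p < N \<Longrightarrow> mv N (iteration_mat n Bs) v p = rho_it n Bs * v p" by blast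
  obtain k b where kb: "k < length Bs" "b < n" "p = k*n+b"
    using block_index_cases[of p "length Bs" n] v(2) by (auto simp: N_def)
  show thesis
  proof (rule that[of "\<lambda>i c. v (i*n+c)" k b])
    fix i a assume ia: "i < length Bs" "a < n"
    then have p: "i*n+a < N" by (simp add: N_def block_index_less)
    show "0 \<le> v (i*n+a)" using v(1)[OF p] .
    have "mv N (L_blocks n Bs) (mv N (iteration_mat n Bs) v) (i*n+a)
      = mv N (L_blocks n Bs) (\<lambda>p. rho_it n Bs * v p) (i*n+a)"
      using v(4) by (intro mv_cong) auto
    then show "sweep n Bs (rho_it n Bs) (\<lambda>i c. v (i*n+c)) i a = rho_it n Bs * v (i*n+a)"
      using iteration_mat_fixpoint[OF p[unfolded N_def], of v] v(4)[OF p]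
      by (simp add: sweep_blocks[OF ia] mv_scale flip: N_def)
  qed (use kb v in auto)
qed

text \<open>With \<open>w = T v - l v\<close>, \<open>(I - L) w = (l L + U) v - l v\<close> is
  nonnegative. Hence \<open>w\<close> is too, and \<open>v\<close> is a subsolution for
  \<open>T\<close>.\<close>

lemma sweep_subsolution:
  assumes parts: "nonneg_parts n A Bs" and l: "0 \<le> l"
    and x: "\<And>i a. i < length Bs \<Longrightarrow> a < n \<Longrightarrow> 0 \<le> x i a" "k < length Bs" "b < n" "0 < x k b"
    and sub: "\<And>i a. i < length Bs \<Longrightarrow> a < n \<Longrightarrow> l * x i a \<le> sweep n Bs l x i a"
  shows "l \<le> rho_it n Bs"
proof -
  define N where "N = length Bs * n"
  note T = iteration_mat_eq(1)[of n Bs, folded N_def]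
  define v where "v = (\<lambda>p. x (p div n) (p mod n))"
  have vx: "v (i*n+a) = x i a" if "a < n" for i a using that by (simp add: v_def)
  have sw: "sweep n Bs l (\<lambda>i c. v (i*n+c)) i a = sweep n Bs l x i a" for i a
    unfolding sweep_def by (intro arg_cong2[of _ _ _ _ "(+)"] arg_cong2[of _ _ _ _ "(*)"] sum.cong refl mv_cong vx)
  have ge: "l * v p \<le> mv N (iteration_mat n Bs) v p" if p: "p < N" for p
  proof -
    define w where "w = (\<lambda>p. mv N (iteration_mat n Bs) v p - l * v p)"
    have "0 \<le> w p"
    proof (rule L_blocks_monotone[OF parts p[unfolded N_def]], fold N_def)
      fix p assume p: "p < N"
      obtain i a where ia: "i < length Bs" "a < n" "p = i*n+a"
        using block_index_cases[of p "length Bs" n] p by (auto simp: N_def)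
      have "l * v p \<le> l * mv N (L_blocks n Bs) v p + mv N (U_blocks n Bs) v p"
        using sub[OF ia(1,2)] sw[of i a] vx[OF ia(2), of i] sweep_blocks[OF ia(1,2), of l v]
        by (simp add: ia(3) N_def)
      then show "mv N (L_blocks n Bs) w p \<le> w p"
        using iteration_mat_fixpoint[OF p[unfolded N_def], of v]
        by (simp add: w_def mv_diff mv_scale flip: N_def)
    qed
    then show ?thesis by (simp add: w_def)
  qed
  show ?thesis
  proof (rule subsolution_le_spectral_radius[OF T iteration_mat_nonneg[OF parts] _ _ _ ge])
    fix p assume "p < N"
    then show "0 \<le> v p"
      using block_index_cases[of p "length Bs" n] x(1) vx by (metis N_def)
  next
    show "k*n+b < N" using x by (simp add: N_def block_index_less)
    show "0 < v (k*n+b)" using x vx by simp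
  qed
qed

section \<open>Strict subsolutions for an irreducible matrix\<close>

lemma irreducible_mat_carrier: "irreducible_mat n A \<Longrightarrow> A \<in> carrier_mat n n"
  by (simp add: irreducible_mat_def)

text \<open>The zero set of \<open>z\<close> is a nonempty proper index set, so irreducibility
  supplies an entry leading from it into the support.\<close>

lemma irreducible_support_grows:
  assumes irr: "irreducible_mat n A" and nn: "nonneg_mat A"
    and z: "\<And>a. a < n \<Longrightarrow> 0 \<le> z a" "b < n" "0 < z b" "b' < n" "z b' = 0"
  obtains a where "a < n" "z a = 0" "0 < mv n A z a"
proof -
  note A = irreducible_mat_carrier[OF irr]
  define I where "I = {a. a < n \<and> z a = 0}"
  have "b' \<in> I" "b \<notin> I" "b \<in> {..<n}" "I \<subseteq> {..<n}" using z(2-5) by (auto simp: I_def)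
  then have "I \<noteq> {} \<and> I \<subset> {..<n}" by blast
  then have "\<not> (\<forall>a\<in>I. \<forall>c\<in>{..<n} - I. A $$ (a,c) = 0)"
    using irr unfolding irreducible_mat_def by blast
  then obtain a c where ac: "a \<in> I" "c < n" "c \<notin> I" "A $$ (a,c) \<noteq> 0" by auto
  then have a: "a < n" "z a = 0" and zc: "0 < z c" using z(1)[of c] by (auto simp: I_def)
  have "0 \<le> A $$ (a,c)" using nn A a ac(2) by (auto simp: nonneg_mat_def)
  then have "0 < A $$ (a,c) * z c" using ac(4) zc by simp
  also have "\<dots> \<le> mv n A z a" using mv_entry_le[OF A nn a(1) ac(2) z(1)] .
  finally show thesis using that a by blast
qed

text \<open>If \<open>x\<close> had a zero, then at some zero of \<open>x\<close> the vector
  \<open>A x\<close> would be positive although \<open>k x\<close> vanishes there.\<close>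

lemma irreducible_positive:
  assumes irr: "irreducible_mat n A" and nn: "nonneg_mat A"
    and x: "\<And>a. a < n \<Longrightarrow> 0 \<le> x a" "b < n" "0 < x b"
    and sup: "\<And>a. a < n \<Longrightarrow> mv n A x a \<le> k * x a" and "a < n"
  shows "0 < x a"
proof (rule ccontr)
  assume "\<not> ?thesis"
  then have "x a = 0" using x(1)[OF \<open>a < n\<close>] by simp
  from irreducible_support_grows[OF irr nn x \<open>a < n\<close> this]
  obtain c where "c < n" "x c = 0" "0 < mv n A x c" by metis
  with sup[of c] show False by simp
qed

lemma sweep_mono:
  assumes parts: "nonneg_parts n A Bs" and l: "0 \<le> l" and ia: "i < length Bs" "a < n"
    and xy: "\<And>j c. j < length Bs \<Longrightarrow> c < n \<Longrightarrow> x j c \<le> y j c"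
  shows "sweep n Bs l x i a \<le> sweep n Bs l y i a"
  unfolding sweep_def using assms
  by (intro add_mono mult_left_mono sum_mono mv_mono nonneg_parts_nth[OF parts]) auto

lemma sweep_add: "sweep n Bs l (\<lambda>i a. x i a + y i a) i a = sweep n Bs l x i a + sweep n Bs l y i a"
  by (simp add: sweep_def mv_add sum.distrib algebra_simps)

lemma sweep_scale: "sweep n Bs l (\<lambda>i a. k * x i a) i a = k * sweep n Bs l x i a"
  by (simp add: sweep_def mv_scale sum_distrib_left algebra_simps)

lemma split_sum_parts:
  assumes "nonneg_parts n A Bs" "a < n" "i \<le> length Bs"
  shows "(\<Sum>j<i. mv n (Bs ! j) z a) + (\<Sum>j=i..<length Bs. mv n (Bs ! j) z a) = mv n A z a"
  using sum_mv_parts[OF assms(1,2), of z]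
    sum.atLeastLessThan_concat[of 0 i "length Bs" "\<lambda>j. mv n (Bs ! j) z a"] assms(3)
  by (simp add: atLeast0LessThan)

text \<open>On equal blocks the two partial sums add up to \<open>A z\<close>; their weights
  \<open>l\<close> and 1 are both at least \<open>min 1 l\<close>.\<close>

lemma sweep_const_ge:
  assumes parts: "nonneg_parts n A Bs" and l: "0 \<le> l" and ia: "i < length Bs" "a < n"
    and z: "\<And>a. a < n \<Longrightarrow> 0 \<le> z a"
  shows "min 1 l * mv n A z a \<le> sweep n Bs l (\<lambda>_. z) i a"
proof -
  have nn: "0 \<le> mv n (Bs ! j) z a" if "j < length Bs" for j
    using nonneg_parts_nth[OF parts that] ia z by (intro mv_nonneg)
  let ?P = "\<Sum>j<i. mv n (Bs ! j) z a" and ?Q = "\<Sum>j=i..<length Bs. mv n (Bs ! j) z a"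
  have "0 \<le> ?P" "0 \<le> ?Q" using nn ia by (auto intro!: sum_nonneg)
  then have "min 1 l * ?P \<le> l * ?P" "min 1 l * ?Q \<le> 1 * ?Q"
    by (intro mult_right_mono; simp)+
  moreover have "mv n A z a = ?P + ?Q" using split_sum_parts[OF parts ia(2), of i z] ia by simp
  ultimately show ?thesis by (simp add: sweep_def distrib_left)
qed

lemma ex_scale_le:
  fixes f g :: "'b \<Rightarrow> real"
  assumes "finite S" "\<And>p. p \<in> S \<Longrightarrow> 0 \<le> f p" "\<And>p. p \<in> S \<Longrightarrow> 0 < g p"
  shows "\<exists>e>0. \<forall>p\<in>S. e * f p \<le> g p"
  using assms
proof (induction S)
  case empty show ?case by (intro exI[of _ 1]) simp
next
  case (insert q S)
  then obtain e where e: "e > 0" "\<forall>p\<in>S. e * f p \<le> g p" by auto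
  define e' where "e' = min e (g q / (f q + 1))"
  have fq: "0 \<le> f q" "0 < g q" using insert by auto
  have "e' > 0" using e fq by (simp add: e'_def)
  moreover have "e' * f p \<le> g p" if "p \<in> S" for p
    using e(2) that mult_right_mono[of e' e "f p"] insert.prems(1)[of p] by (fastforce simp: e'_def)
  moreover have "e' * f q \<le> g q"
  proof -
    have "e' * f q \<le> g q / (f q + 1) * f q" using fq by (intro mult_right_mono) (auto simp: e'_def)
    also have "\<dots> \<le> g q" using fq by (simp add: field_simps)
    finally show ?thesis .
  qed
  ultimately show ?case by auto
qed

text \<open>Replacing \<open>y\<close> by \<open>y + K y\<close>, where \<open>K\<close> is the sweep operator, enlarges the support of the
  excess \<open>z\<close> until it is everywhere positive.\<close>
lemma strict_subsolution:
  assumes irr: "irreducible_mat n A" and nn: "nonneg_mat A"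
    and parts: "nonneg_parts n A Bs" and l: "0 < l"
    and y: "\<And>i a. i < length Bs \<Longrightarrow> a < n \<Longrightarrow> 0 \<le> y i a" "k < length Bs" "b < n" "0 < y k b"
    and z: "\<And>a. a < n \<Longrightarrow> 0 \<le> z a" "b' < n" "0 < z b'"
    and sub: "\<And>i a. i < length Bs \<Longrightarrow> a < n \<Longrightarrow> l * y i a + z a \<le> sweep n Bs l y i a"
  shows "l < rho_it n Bs"
  using y z sub
proof (induction "card {a. a < n \<and> z a = 0}" arbitrary: y z b' rule: less_induct)
  case less
  note y = less.prems(1-4) and z = less.prems(5-7) and sub = less.prems(8)
  have swnn: "0 \<le> sweep n Bs l y i a" if "i < length Bs" "a < n" for i a
    using sub[OF that] y(1)[OF that] z(1)[OF that(2)] l by (smt (verit) mult_nonneg_nonneg)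
  show ?case
  proof (cases "\<exists>b<n. z b = 0")
    case False
    then have zpos: "0 < z a" if "a < n" for a using z(1)[OF that] that by fastforce
    \<comment> \<open>An everywhere positive excess absorbs a small multiple of \<open>y\<close>, so
      the level can be raised to \<open>l + e\<close>. Raising it inside the sweep as well only
      enlarges the right-hand side.\<close>
    have "\<exists>e>0. \<forall>p\<in>{..<length Bs} \<times> {..<n}. e * y (fst p) (snd p) \<le> z (snd p)"
      using y(1) zpos by (intro ex_scale_le) auto
    then obtain e where e: "e > 0" "\<And>i a. i < length Bs \<Longrightarrow> a < n \<Longrightarrow> e * y i a \<le> z a" by auto
    have "l + e \<le> rho_it n Bs"
    proof (rule sweep_subsolution[where x = y, OF parts _ y])
      fix i a assume ia: "i < length Bs" "a < n"
      have "(l + e) * y i a \<le> sweep n Bs l y i a"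
        using sub[OF ia] e(2)[OF ia] by (simp add: distrib_right)
      also have "0 \<le> (\<Sum>j<i. mv n (Bs ! j) (y j) a)"
        using ia y(1) nonneg_parts_nth[OF parts] by (intro sum_nonneg mv_nonneg) auto
      then have "sweep n Bs l y i a \<le> sweep n Bs (l + e) y i a"
        using e(1) by (simp add: sweep_def distrib_right)
      finally show "(l + e) * y i a \<le> sweep n Bs (l + e) y i a" .
    qed (use l e in auto)
    then show ?thesis using e by simp
  next
    case True
    then obtain b0 where "b0 < n" "z b0 = 0" by blast
    from irreducible_support_grows[OF irr nn z this]
    obtain a0 where a0: "a0 < n" "z a0 = 0" "0 < mv n A z a0" by metis
    define y' where "y' = (\<lambda>i a. y i a + sweep n Bs l y i a)"
    \<comment> \<open>Applying the sweep to \<open>l y + z <= K y\<close> contributes the extra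
      excess \<open>K z\<close>. Its lower bound \<open>min 1 l * A z\<close> does not depend on the
      block, so the induction hypothesis fits.\<close>
    define z' where "z' = (\<lambda>a. z a + min 1 l * mv n A z a)"
    have Az: "0 \<le> min 1 l * mv n A z a" if "a < n" for a
      using mv_nonneg[OF irreducible_mat_carrier[OF irr] nn that z(1)] l by simp
    show ?thesis
    proof (rule less.hyps[of z' y' b'])
      have "{a. a < n \<and> z' a = 0} \<subseteq> {a. a < n \<and> z a = 0}"
        using z(1) Az by (force simp: z'_def)
      moreover have "a0 \<in> {a. a < n \<and> z a = 0} - {a. a < n \<and> z' a = 0}"
        using a0 l by (auto simp: z'_def)
      ultimately show "card {a. a < n \<and> z' a = 0} < card {a. a < n \<and> z a = 0}"
        by (intro psubset_card_mono) auto
      show "0 \<le> y' i a" if "i < length Bs" "a < n" for i a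
        using y(1)[OF that] swnn[OF that] by (simp add: y'_def)
      show "0 < y' k b" using y(4) swnn[OF y(2,3)] by (simp add: y'_def)
      show "0 \<le> z' a" if "a < n" for a using z(1)[OF that] Az[OF that] by (simp add: z'_def)
      show "0 < z' b'" using z(3) Az[OF z(2)] by (simp add: z'_def)
      fix i a assume ia: "i < length Bs" "a < n"
      have "l * sweep n Bs l y i a + min 1 l * mv n A z a
        \<le> sweep n Bs l (\<lambda>i a. l * y i a) i a + sweep n Bs l (\<lambda>_. z) i a"
        using sweep_const_ge[OF parts _ ia, of l z] z(1) l by (simp add: sweep_scale)
      also have "\<dots> = sweep n Bs l (\<lambda>i a. l * y i a + z a) i a" by (simp add: sweep_add)
      also have "\<dots> \<le> sweep n Bs l (\<lambda>i a. sweep n Bs l y i a) i a"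
        using sub l by (intro sweep_mono[OF parts _ ia]) auto
      finally show "l * y' i a + z' a \<le> sweep n Bs l y' i a"
        using sub[OF ia] by (simp add: y'_def z'_def sweep_add algebra_simps)
    qed (use y z in auto)
  qed
qed

section \<open>Eigenvectors of the sweep operator\<close>

definition sweep_eigen :: "nat \<Rightarrow> real mat list \<Rightarrow> real \<Rightarrow> (nat \<Rightarrow> nat \<Rightarrow> real) \<Rightarrow> bool" where
  "sweep_eigen n Bs l x \<longleftrightarrow>
     (\<forall>i<length Bs. \<forall>a<n. 0 \<le> x i a) \<and> (\<exists>k<length Bs. \<exists>b<n. 0 < x k b) \<and>
     (\<forall>i<length Bs. \<forall>a<n. sweep n Bs l x i a = l * x i a)"

lemma sweep_eigen_exists:
  assumes "nonneg_parts n A Bs" "n > 0"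
  obtains x where "sweep_eigen n Bs (rho_it n Bs) x"
  using iteration_Perron_vector[OF assms] unfolding sweep_eigen_def by metis

lemma sweep_eigen_step:
  assumes x: "sweep_eigen n Bs l x" and i: "Suc i < length Bs" and a: "a < n"
  shows "l * (x (Suc i) a - x i a) = (l - 1) * mv n (Bs ! i) (x i) a"
proof -
  have "sweep n Bs l x (Suc i) a - sweep n Bs l x i a = (l - 1) * mv n (Bs ! i) (x i) a"
    using i by (simp add: sweep_def sum.atLeast_Suc_lessThan[of i "length Bs"] algebra_simps)
  then show ?thesis using x i a by (simp add: sweep_eigen_def right_diff_distrib)
qed

lemma sweep_eigen_first:
  assumes "sweep_eigen n Bs l x" "Bs \<noteq> []" "a < n"
  shows "l * x 0 a = (\<Sum>j<length Bs. mv n (Bs ! j) (x j) a)"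
  using assms by (auto simp: sweep_eigen_def sweep_def atLeast0LessThan)

text \<open>Last row against \<open>l\<close> times row 0: the recursion of
  \<open>sweep_eigen_step\<close> continues past the end as if the next block were
  \<open>l * x 0\<close>.\<close>

lemma sweep_eigen_wrap:
  assumes x: "sweep_eigen n Bs l x" and d: "length Bs = Suc m" and a: "a < n"
  shows "l * (l * x 0 a - x m a) = (l - 1) * mv n (Bs ! m) (x m) a"
proof -
  have "sweep n Bs l x m a = l * x m a" using x a d by (simp add: sweep_eigen_def)
  then have "l * x m a = l * (\<Sum>j<m. mv n (Bs ! j) (x j) a) + mv n (Bs ! m) (x m) a"
    using d by (simp add: sweep_def)
  moreover have "l * x 0 a = (\<Sum>j<m. mv n (Bs ! j) (x j) a) + mv n (Bs ! m) (x m) a"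
    using sweep_eigen_first[OF x _ a] d by fastforce
  ultimately show ?thesis by (simp add: algebra_simps)
qed

lemma sweep_eigen_bounds:
  assumes x: "sweep_eigen n Bs l x" and parts: "nonneg_parts n A Bs" and l: "0 < l"
    and ia: "i < length Bs" "a < n"
  shows "1 \<le> l \<Longrightarrow> x 0 a \<le> x i a \<and> x i a \<le> l * x 0 a"
    and "l \<le> 1 \<Longrightarrow> l * x 0 a \<le> x i a \<and> x i a \<le> x 0 a"
proof -
  \<comment> \<open>Extending the blocks by \<open>l * x 0\<close> merges the step and wrap
    equations into one recursion, monotone from \<open>x 0\<close> to \<open>l * x 0\<close>; the
    sign of \<open>l - 1\<close> decides the direction.\<close>
  define X where "X = (\<lambda>i. if i < length Bs then x i a else l * x 0 a)"
  have step: "l * (X (Suc i) - X i) = (if i < length Bs then (l - 1) * mv n (Bs ! i) (x i) a else 0)" for i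
    using sweep_eigen_step[OF x, of i a] sweep_eigen_wrap[OF x, of i a] ia(2)
    by (auto simp: X_def not_less less_Suc_eq le_Suc_eq)
  have nn: "0 \<le> mv n (Bs ! i) (x i) a" if "i < length Bs" for i
    using nonneg_parts_nth[OF parts that] ia x that by (intro mv_nonneg) (auto simp: sweep_eigen_def)
  have ends: "X 0 = x 0 a" "X i = x i a" "X (length Bs) = l * x 0 a" using ia by (auto simp: X_def)
  show "x 0 a \<le> x i a \<and> x i a \<le> l * x 0 a" if "1 \<le> l"
  proof -
    have "0 \<le> l * (X (Suc i) - X i)" for i using step[of i] nn[of i] that by auto
    then have "incseq X" using l by (intro incseq_SucI) (simp add: zero_le_mult_iff)
    from incseqD[OF this, of 0 i] incseqD[OF this, of i "length Bs"] show ?thesis using ends ia by simp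
  qed
  show "l * x 0 a \<le> x i a \<and> x i a \<le> x 0 a" if "l \<le> 1"
  proof -
    have "l * (X (Suc i) - X i) \<le> 0" for i
      using step[of i] nn[of i] that by (auto intro: mult_nonpos_nonneg)
    then have "decseq X" using l by (intro decseq_SucI) (simp add: mult_le_0_iff)
    from decseqD[OF this, of 0 i] decseqD[OF this, of i "length Bs"] show ?thesis using ends ia by simp
  qed
qed

text \<open>All blocks are comparable with block 0, which therefore satisfies
  \<open>A x <= (l / min 1 l) x\<close>; irreducibility makes it positive, and the lower bound
  passes this on to every block.\<close>

lemma sweep_eigen_positive:
  assumes irr: "irreducible_mat n A" and nn: "nonneg_mat A"
    and x: "sweep_eigen n Bs l x" and parts: "nonneg_parts n A Bs" and l: "0 < l"
    and ia: "i < length Bs" "a < n"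
  shows "0 < x i a"
proof -
  have d: "0 < length Bs" "Bs \<noteq> []" using ia by auto
  have lo: "min 1 l * x 0 c \<le> x j c" and hi: "x j c \<le> max 1 l * x 0 c"
    if "j < length Bs" "c < n" for j c
    using sweep_eigen_bounds[OF x parts l that] by (cases "l \<le> 1"; simp add: min_def max_def)+
  have x0: "0 \<le> x 0 c" if "c < n" for c using x that d by (simp add: sweep_eigen_def)
  obtain k b where kb: "k < length Bs" "b < n" "0 < x k b" using x by (auto simp: sweep_eigen_def)
  then have b: "0 < x 0 b" using hi[OF kb(1,2)] x0[OF kb(2)]
    by (metis less_eq_real_def mult_zero_right not_less)
  have "0 < x 0 a"
  proof (rule irreducible_positive[where x = "x 0" and k = "l / min 1 l", OF irr nn x0 kb(2) b _ ia(2)])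
    fix c assume c: "c < n"
    have "min 1 l * mv n A (x 0) c = (\<Sum>j<length Bs. mv n (Bs ! j) (\<lambda>c. min 1 l * x 0 c) c)"
      by (simp add: mv_scale sum_mv_parts[OF parts c] flip: sum_distrib_left)
    also have "\<dots> \<le> (\<Sum>j<length Bs. mv n (Bs ! j) (x j) c)"
      using nonneg_parts_nth[OF parts] lo c by (intro sum_mono mv_mono) auto
    also have "\<dots> = l * x 0 c" using sweep_eigen_first[OF x d(2) c] by simp
    finally show "mv n A (x 0) c \<le> l / min 1 l * x 0 c" using l by (simp add: field_simps)
  qed
  then have "0 < min 1 l * x 0 a" using l by simp
  with lo[OF ia] show ?thesis by simp
qed

section \<open>Comparison with the unsplit matrix\<close>

lemma iteration_spectral_radius_nonneg:
  assumes "nonneg_parts n A Bs" "n > 0"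
  shows "0 \<le> rho_it n Bs"
  using assms by (intro real_spectral_radius_nonneg[OF iteration_mat_eq(1)]) (simp add: nonneg_parts_def)

lemma iteration_mat_singleton:
  assumes "A \<in> carrier_mat n n"
  shows "iteration_mat n [A] = A"
proof -
  have "1\<^sub>m n - L_blocks n [A] = 1\<^sub>m n" "U_blocks n [A] = A"
    using assms by (auto simp: L_blocks_def U_blocks_def block_mat_def intro!: eq_matI)
  with iteration_mat_eq[where n = n and Bs = "[A]"] show ?thesis by simp
qed

text \<open>For \<open>l <= 1\<close> no block exceeds \<open>x 0\<close>, so row 0 of the
  eigenvalue equation makes \<open>x 0\<close> a subsolution for \<open>A\<close>.\<close>

lemma iteration_le_if_le_1:
  assumes A: "A \<in> carrier_mat n n" "nonneg_mat A" and parts: "nonneg_parts n A Bs" and n: "n > 0"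
    and le: "rho_it n Bs \<le> 1"
  shows "rho_it n Bs \<le> real_spectral_radius A"
proof (cases "rho_it n Bs = 0")
  case True
  then show ?thesis using real_spectral_radius_nonneg[OF A(1) n] by simp
next
  case False
  define l where "l = rho_it n Bs"
  have l: "0 < l" "l \<le> 1" using False le iteration_spectral_radius_nonneg[OF parts n] by (auto simp: l_def)
  obtain x where x: "sweep_eigen n Bs l x" using sweep_eigen_exists[OF parts n] l_def by blast
  have ne: "Bs \<noteq> []" using parts by (simp add: nonneg_parts_def)
  note bd = sweep_eigen_bounds(2)[OF x parts l(1) _ _ l(2)]
  obtain k b where kb: "k < length Bs" "b < n" "0 < x k b" using x by (auto simp: sweep_eigen_def)
  have "l \<le> real_spectral_radius A"
  proof (rule subsolution_le_spectral_radius[OF A])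
    show "0 \<le> x 0 a" if "a < n" for a using x ne that by (simp add: sweep_eigen_def)
    show "b < n" "0 < x 0 b" using kb bd[OF kb(1,2)] by auto
    fix a assume a: "a < n"
    have "l * x 0 a = (\<Sum>j<length Bs. mv n (Bs ! j) (x j) a)" by (rule sweep_eigen_first[OF x ne a])
    also have "\<dots> \<le> (\<Sum>j<length Bs. mv n (Bs ! j) (x 0) a)"
      using nonneg_parts_nth[OF parts] bd a by (intro sum_mono mv_mono) auto
    also have "\<dots> = mv n A (x 0) a" by (rule sum_mv_parts[OF parts a])
    finally show "l * x 0 a \<le> mv n A (x 0) a" .
  qed
  then show ?thesis by (simp add: l_def)
qed

text \<open>Used contrapositively to get \<open>rho(T) <= 1\<close> from \<open>rho(A) <= 1\<close>.
  All blocks are at most \<open>l * x 0\<close>, and block 0 falls short of this bound by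
  \<open>(l - 1) * x 0\<close>, which leaves an excess over \<open>x 0\<close> in
  \<open>A (x 0)\<close>.\<close>

lemma iteration_gt_1:
  assumes irr: "irreducible_mat n A" and nn: "nonneg_mat A"
    and parts: "nonneg_parts n A Bs" and n: "n > 0" and gt: "1 < rho_it n Bs"
  shows "1 < real_spectral_radius A"
proof -
  note A = irreducible_mat_carrier[OF irr]
  define l where "l = rho_it n Bs"
  have l: "1 < l" "0 < l" "1 \<le> l" using gt by (auto simp: l_def)
  obtain x where x: "sweep_eigen n Bs l x" using sweep_eigen_exists[OF parts n] l_def by blast
  have d: "Bs \<noteq> []" "0 < length Bs" using parts by (auto simp: nonneg_parts_def)
  note bd = sweep_eigen_bounds(1)[OF x parts l(2) _ _ l(3)]
  note B0 = nonneg_parts_nth[OF parts d(2)]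
  have xpos: "0 < x 0 a" if "a < n" for a
    using sweep_eigen_positive[OF irr nn x parts l(2) d(2) that] .
  have excess: "x 0 a + (1 - 1/l) * mv n (Bs ! 0) (x 0) a \<le> mv n A (x 0) a" if a: "a < n" for a
  proof -
    have t: "0 \<le> l * mv n (Bs ! j) (x 0) a - mv n (Bs ! j) (x j) a" if "j < length Bs" for j
      using mv_mono[OF nonneg_parts_nth(1,2)[OF parts that] a, of "x j" "\<lambda>c. l * x 0 c"] bd[OF that]
      by (simp add: mv_scale)
    have "(l - 1) * mv n (Bs ! 0) (x 0) a = l * mv n (Bs ! 0) (x 0) a - mv n (Bs ! 0) (x 0) a"
      by (simp add: algebra_simps)
    \<comment> \<open>All summands are nonnegative; only the one for \<open>j = 0\<close>, where the
      gap is explicit, is kept.\<close>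
    also have "\<dots> \<le> (\<Sum>j<length Bs. l * mv n (Bs ! j) (x 0) a - mv n (Bs ! j) (x j) a)"
      using t d by (intro member_le_sum[where f = "\<lambda>j. l * mv n (Bs ! j) (x 0) a - mv n (Bs ! j) (x j) a"]) auto
    also have "\<dots> = l * mv n A (x 0) a - l * x 0 a"
      using sweep_eigen_first[OF x d(1) a] sum_mv_parts[OF parts a, of "x 0"]
      by (simp add: sum_subtractf flip: sum_distrib_left)
    finally show ?thesis using l by (simp add: field_simps)
  qed
  have B0x: "0 \<le> mv n (Bs ! 0) (x 0) a" if "a < n" for a
    using that xpos by (intro mv_nonneg[OF B0(1,2)]) (auto intro: less_imp_le)
  obtain b c where bc: "b < n" "c < n" "0 < (Bs ! 0) $$ (b,c)" using nonzero_nonneg_entry[OF B0] .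
  have "0 < (Bs ! 0) $$ (b,c) * x 0 c" using bc xpos by simp
  also have "\<dots> \<le> mv n (Bs ! 0) (x 0) b"
    using xpos by (intro mv_entry_le[OF B0(1,2) bc(1,2)]) (auto intro: less_imp_le)
  finally have b: "0 < mv n (Bs ! 0) (x 0) b" .
  \<comment> \<open>\<open>A\<close> must be nonzero for \<open>[A]\<close> to count as a list of
    parts. Its iteration matrix is \<open>A\<close>, so \<open>strict_subsolution\<close> then
    speaks about \<open>A\<close> itself, at level 1.\<close>
  have "mv n A (x 0) b \<noteq> 0"
    using excess[OF bc(1)] xpos[OF bc(1)] b l by (smt (verit) divide_le_eq_1_pos mult_nonneg_nonneg)
  then have "A \<noteq> 0\<^sub>m n n" using bc(1) by (auto simp: mv_zero_mat)
  then have single: "nonneg_parts n A [A]" using A nn by (simp add: nonneg_parts_def)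
  have "1 < rho_it n [A]"
  proof (rule strict_subsolution[OF irr nn single, where y = "\<lambda>_. x 0" and k = 0 and b = b and b' = b
        and z = "\<lambda>a. (1 - 1/l) * mv n (Bs ! 0) (x 0) a"])
    show "0 < (1 - 1/l) * mv n (Bs ! 0) (x 0) b" using b l by simp
    show "0 \<le> (1 - 1/l) * mv n (Bs ! 0) (x 0) a" if "a < n" for a using B0x[OF that] l by simp
    fix i a assume "i < length [A]" and a: "a < n"
    then have "sweep n [A] 1 (\<lambda>_. x 0) i a = mv n A (x 0) a" by (simp add: sweep_def)
    then show "1 * x 0 a + (1 - 1/l) * mv n (Bs ! 0) (x 0) a \<le> sweep n [A] 1 (\<lambda>_. x 0) i a"
      using excess[OF a] by simp
  qed (use bc xpos in \<open>auto intro: less_imp_le\<close>)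
  then show ?thesis by (simp add: iteration_mat_singleton[OF A])
qed

text \<open>Repeating a Perron vector of \<open>A\<close> in every block gives a subsolution at
  level \<open>R\<close>, because \<open>min 1 R = 1\<close>.\<close>

lemma iteration_ge_if_ge_1:
  assumes A: "A \<in> carrier_mat n n" "nonneg_mat A" and parts: "nonneg_parts n A Bs" and n: "n > 0"
    and ge: "1 \<le> real_spectral_radius A"
  shows "real_spectral_radius A \<le> rho_it n Bs"
proof -
  define R where "R = real_spectral_radius A"
  obtain v b where v: "\<And>a. a < n \<Longrightarrow> 0 \<le> v a" "b < n" "0 < v b"
    "\<And>a. a < n \<Longrightarrow> mv n A v a = R * v a"
    using nonneg_mat_Perron_vector[OF A n] unfolding R_def by blast
  have d: "0 < length Bs" using parts by (auto simp: nonneg_parts_def)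
  have "R \<le> rho_it n Bs"
  proof (rule sweep_subsolution[where x = "\<lambda>_. v", OF parts _ v(1) _ v(2,3)])
    fix i a assume ia: "i < length Bs" "a < n"
    show "R * v a \<le> sweep n Bs R (\<lambda>_. v) i a"
      using sweep_const_ge[OF parts _ ia, of R v] v ge ia by (simp add: R_def min_def)
  qed (use ge d in \<open>auto simp: R_def\<close>)
  then show ?thesis by (simp add: R_def)
qed

text \<open>The vector with blocks \<open>\<rho>\<^sup>i v\<close>, where \<open>v\<close> is a Perron vector of \<open>A\<close>, is a subsolution at
  level \<open>\<rho>\<^sup>d\<close>.\<close>
lemma iteration_spectral_radius_pos:
  assumes A: "A \<in> carrier_mat n n" "nonneg_mat A" and parts: "nonneg_parts n A Bs" and n: "n > 0"
    and R: "0 < real_spectral_radius A" "real_spectral_radius A \<le> 1"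
  shows "0 < rho_it n Bs"
proof -
  define R where "R = real_spectral_radius A"
  have R: "0 < R" "R \<le> 1" using R by (auto simp: R_def)
  obtain v b where v: "\<And>a. a < n \<Longrightarrow> 0 \<le> v a" "b < n" "0 < v b"
    "\<And>a. a < n \<Longrightarrow> mv n A v a = R * v a"
    using nonneg_mat_Perron_vector[OF A n] unfolding R_def by blast
  define d where "d = length Bs"
  have d: "0 < length Bs" using parts by (auto simp: nonneg_parts_def)
  then obtain e where e: "d = Suc e" unfolding d_def using gr0_implies_Suc by blast
  have "R ^ d \<le> rho_it n Bs"
  proof (rule sweep_subsolution[OF parts, where x = "\<lambda>i a. R ^ i * v a" and k = 0 and b = b])
    fix i a assume ia: "i < length Bs" "a < n"
    have nnB: "0 \<le> mv n (Bs ! j) v a" if "j < length Bs" for j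
      using nonneg_parts_nth[OF parts that] ia v(1) by (intro mv_nonneg)
    have "R ^ d * (R ^ i * v a) = R ^ (d + i - 1) * mv n A v a"
      using v(4)[OF ia(2)] by (simp add: e power_add)
    also have "\<dots> = (\<Sum>j<i. R ^ (d + i - 1) * mv n (Bs ! j) v a)
        + (\<Sum>j=i..<length Bs. R ^ (d + i - 1) * mv n (Bs ! j) v a)"
      using split_sum_parts[OF parts ia(2), of i v] ia
      by (simp flip: sum_distrib_left distrib_left)
    \<comment> \<open>Since \<open>R <= 1\<close>, lowering exponents enlarges powers:
      \<open>d + j <= d + i - 1\<close> for \<open>j < i\<close>, and \<open>j <= d + i - 1\<close>
      for \<open>j < d\<close>.\<close>
    also have "\<dots> \<le> (\<Sum>j<i. R ^ (d + j) * mv n (Bs ! j) v a)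
        + (\<Sum>j=i..<length Bs. R ^ j * mv n (Bs ! j) v a)"
      using R nnB ia d
      by (intro add_mono sum_mono mult_right_mono power_decreasing) (auto simp: d_def)
    also have "\<dots> = sweep n Bs (R ^ d) (\<lambda>i a. R ^ i * v a) i a"
      by (simp add: sweep_def mv_scale sum_distrib_left power_add mult.assoc)
    finally show "R ^ d * (R ^ i * v a) \<le> sweep n Bs (R ^ d) (\<lambda>i a. R ^ i * v a) i a" .
  qed (use v R d in auto)
  moreover have "0 < R ^ d" using R by simp
  ultimately show ?thesis by linarith
qed

section \<open>Cyclic shifts\<close>

lemma length_cyc_shift: "xs \<noteq> [] \<Longrightarrow> length (cyc_shift xs) = length xs"
  by (simp add: cyc_shift_def)

lemma nonneg_parts_cyc_shift:
  assumes "nonneg_parts n A Bs"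
  shows "nonneg_parts n A (cyc_shift Bs)"
proof -
  obtain Xs X where "Bs = Xs @ [X]" using assms unfolding nonneg_parts_def by (metis rev_exhaust)
  then show ?thesis using assms by (auto simp: nonneg_parts_def cyc_shift_def add.commute)
qed

text \<open>The value 0 is treated apart because the shifted eigenvector, most of whose blocks carry
  the factor \<open>l\<close>, could then vanish.\<close>

lemma rho_it_le_cyc_shift:
  assumes parts: "nonneg_parts n A Bs" and n: "n > 0"
  shows "rho_it n Bs \<le> rho_it n (cyc_shift Bs)"
proof (cases "rho_it n Bs = 0")
  case True
  then show ?thesis using iteration_spectral_radius_nonneg[OF nonneg_parts_cyc_shift[OF parts] n] by simp
next
  case False
  define l where "l = rho_it n Bs"
  have l: "0 < l" using False iteration_spectral_radius_nonneg[OF parts n] by (auto simp: l_def)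
  obtain x where x: "sweep_eigen n Bs l x" using sweep_eigen_exists[OF parts n] l_def by blast
  obtain Xs X where Bs: "Bs = Xs @ [X]" using parts unfolding nonneg_parts_def by (metis rev_exhaust)
  define m where "m = length Xs"
  have len: "length Bs = Suc m" "length (cyc_shift Bs) = Suc m"
    by (auto simp: Bs cyc_shift_def m_def)
  have nth: "cyc_shift Bs ! 0 = Bs ! m" "\<And>j. j < m \<Longrightarrow> cyc_shift Bs ! Suc j = Bs ! j"
    by (auto simp: Bs cyc_shift_def m_def nth_append)
  obtain k b where kb: "k < Suc m" "b < n" "0 < x k b" using x len by (auto simp: sweep_eigen_def)
  define y where "y = (\<lambda>i. case i of 0 \<Rightarrow> x m | Suc j \<Rightarrow> \<lambda>a. l * x j a)"
  \<comment> \<open>The block with a positive entry moves one place on, the last one to the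
    front.\<close>
  define k' where "k' = (if k = m then 0 else Suc k)"
  have eq: "sweep n (cyc_shift Bs) l y i a = l * y i a" if i: "i < Suc m" and a: "a < n" for i a
  proof -
    have E: "l * x i a = l * (\<Sum>j<i. mv n (Bs ! j) (x j) a)
        + ((\<Sum>j=i..<m. mv n (Bs ! j) (x j) a) + mv n (Bs ! m) (x m) a)" if "i \<le> m" for i
      using x that a len by (simp add: sweep_eigen_def sweep_def)
    have sh: "(\<Sum>j=Suc p..<Suc q. mv n (cyc_shift Bs ! j) (y j) a) = l * (\<Sum>j=p..<q. mv n (Bs ! j) (x j) a)"
      if "q \<le> m" for p q
      unfolding sum.shift_bounds_Suc_ivl using that
      by (simp add: y_def nth mv_scale sum_distrib_left)
    have first: "(\<Sum>j=0..<Suc q. mv n (cyc_shift Bs ! j) (y j) a)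
        = mv n (Bs ! m) (x m) a + l * (\<Sum>j=0..<q. mv n (Bs ! j) (x j) a)" if "q \<le> m" for q
    proof -
      have "(\<Sum>j=0..<Suc q. mv n (cyc_shift Bs ! j) (y j) a)
        = mv n (cyc_shift Bs ! 0) (y 0) a + (\<Sum>j=Suc 0..<Suc q. mv n (cyc_shift Bs ! j) (y j) a)"
        by (rule sum.atLeast_Suc_lessThan) simp
      then show ?thesis unfolding sh[OF that] by (simp add: nth y_def)
    qed
    show ?thesis
    proof (cases i)
      case 0
      have "sweep n (cyc_shift Bs) l y i a = mv n (Bs ! m) (x m) a + l * (\<Sum>j=0..<m. mv n (Bs ! j) (x j) a)"
        unfolding sweep_def len 0 first[OF order_refl] by simp
      then show ?thesis using E[of m] 0 by (simp add: y_def atLeast0LessThan)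
    next
      case (Suc i')
      have "(\<Sum>j<Suc i'. mv n (cyc_shift Bs ! j) (y j) a)
        = mv n (Bs ! m) (x m) a + l * (\<Sum>j=0..<i'. mv n (Bs ! j) (x j) a)"
        using first[of i'] i Suc unfolding atLeast0LessThan by simp
      then have "sweep n (cyc_shift Bs) l y i a
        = l * (mv n (Bs ! m) (x m) a + l * (\<Sum>j=0..<i'. mv n (Bs ! j) (x j) a))
          + l * (\<Sum>j=i'..<m. mv n (Bs ! j) (x j) a)"
        unfolding sweep_def len Suc sh[OF order_refl] by simp
      also have "\<dots> = l * (l * x i' a)"
        using E[of i'] i Suc by (simp add: algebra_simps atLeast0LessThan)
      finally show ?thesis by (simp add: y_def Suc)
    qed
  qed
  have "l \<le> rho_it n (cyc_shift Bs)"
  proof (rule sweep_subsolution[OF nonneg_parts_cyc_shift[OF parts], where x = y and k = k' and b = b])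
    show "0 \<le> y i a" if "i < length (cyc_shift Bs)" "a < n" for i a
      using x that l len by (auto simp: y_def sweep_eigen_def split: nat.split)
    show "k' < length (cyc_shift Bs)" using kb len by (auto simp: k'_def)
    show "0 < y k' b" using kb l by (auto simp: y_def k'_def)
  qed (use l eq len kb in auto)
  then show ?thesis by (simp add: l_def)
qed

lemma rotate1_cyc_shift: "xs \<noteq> [] \<Longrightarrow> rotate1 (cyc_shift xs) = xs"
  by (simp add: cyc_shift_def)

text \<open>The third claim, that \<open>rotate\<close> inverts the shift, yields the period of the
  shift.\<close>

lemma cyc_shift_funpow_props:
  assumes "nonneg_parts n A Bs"
  shows "nonneg_parts n A ((cyc_shift ^^ r) Bs)" "length ((cyc_shift ^^ r) Bs) = length Bs"
    "rotate r ((cyc_shift ^^ r) Bs) = Bs"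
proof (induction r)
  case (Suc r)
  let ?C = "(cyc_shift ^^ r) Bs"
  { case 1 show ?case using nonneg_parts_cyc_shift Suc(1) by simp }
  have ne: "?C \<noteq> []" using Suc(1) by (simp add: nonneg_parts_def)
  { case 2 show ?case using Suc(2) length_cyc_shift[OF ne] by simp }
  { case 3 show ?case using Suc(3) rotate1_cyc_shift[OF ne]
      by (simp add: rotate_def funpow_swap1) }
qed (use assms in auto)

text \<open>No shift decreases the spectral radius, but a multiple of \<open>length Bs\<close>
  shifts returns to the start, so equality holds throughout.\<close>

lemma rho_it_cyc_shift:
  assumes parts: "nonneg_parts n A Bs" and n: "n > 0"
  shows "rho_it n ((cyc_shift ^^ r) Bs) = rho_it n Bs"
proof -
  let ?g = "\<lambda>r. rho_it n ((cyc_shift ^^ r) Bs)"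
  note props = cyc_shift_funpow_props[OF parts]
  have "incseq ?g"
    using rho_it_le_cyc_shift[OF props(1) n] by (intro incseq_SucI) simp
  moreover have "(cyc_shift ^^ (r * length Bs)) Bs = Bs"
    using props(3)[of "r * length Bs"] props(2)[of "r * length Bs"]
    by (subst (asm) rotate_conv_mod) simp
  moreover have "r \<le> r * length Bs" using parts by (cases Bs) (auto simp: nonneg_parts_def)
  ultimately show ?thesis using incseqD[of ?g 0 r] incseqD[of ?g r "r * length Bs"] by simp
qed

section \<open>Refinements\<close>

lemma mv_mult_pos:
  assumes E: "E \<in> carrier_mat n n" "nonneg_mat E" and F: "F \<in> carrier_mat n n" "nonneg_mat F"
    and ne: "F * E \<noteq> 0\<^sub>m n n" and y: "\<And>a. a < n \<Longrightarrow> 0 < y a"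
  obtains b where "b < n" "0 < mv n F (mv n E y) b"
proof -
  have FE: "F * E \<in> carrier_mat n n" "nonneg_mat (F * E)"
    using E F by (auto simp: nonneg_mat_def scalar_prod_def intro!: sum_nonneg)
  obtain b c where bc: "b < n" "c < n" "0 < (F * E) $$ (b,c)" using nonzero_nonneg_entry[OF FE ne] .
  have "0 < (F * E) $$ (b,c) * y c" using bc y by simp
  also have "\<dots> \<le> mv n (F * E) y b"
    using mv_entry_le[OF FE bc(1,2)] y by (simp add: less_imp_le)
  also have "\<dots> = mv n F (mv n E y) b" using mv_mult[OF F(1) E(1) bc(1)] .
  finally show thesis using that bc by blast
qed

text \<open>Both lists are already shifted so that the refined part stands last:
  \<open>C ! m\<close> is \<open>E + F\<close> with \<open>E = C' ! m\<close> and
  \<open>F = C' ! Suc m\<close>, and the coarse order is \<open>Suc m\<close>.\<close>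

locale refinement =
  fixes n :: nat and A :: "real mat" and C C' :: "real mat list" and m :: nat
  assumes irr: "irreducible_mat n A" and nn: "nonneg_mat A"
    and C: "nonneg_parts n A C" "length C = Suc m"
    and C': "nonneg_parts n A C'" "length C' = Suc (Suc m)"
    and common: "\<And>p. p < m \<Longrightarrow> C' ! p = C ! p"
    and split: "\<And>a c. a < n \<Longrightarrow> c < n \<Longrightarrow> (C ! m) $$ (a,c) = (C' ! m) $$ (a,c) + (C' ! Suc m) $$ (a,c)"
    and ne: "C' ! Suc m * C' ! m \<noteq> 0\<^sub>m n n" and n: "n > 0"
begin

lemma mv_split: "a < n \<Longrightarrow> mv n (C ! m) z a = mv n (C' ! m) z a + mv n (C' ! Suc m) z a"
  by (simp add: mv_def split distrib_right sum.distrib)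

text \<open>Expressed through the fine parts: in rows up to \<open>m\<close> the two sweeps differ
  only in whether \<open>F\<close> acts on block \<open>m\<close> or on block
  \<open>Suc m\<close>.\<close>

lemma sweep_coarse:
  assumes "i \<le> m" "a < n"
  shows "sweep n C l x i a = l * (\<Sum>j<i. mv n (C' ! j) (x j) a)
    + ((\<Sum>j=i..<m. mv n (C' ! j) (x j) a) + (mv n (C' ! m) (x m) a + mv n (C' ! Suc m) (x m) a))"
  using assms by (simp add: sweep_def C mv_split common)

lemma sweep_fine:
  assumes "i \<le> m" "a < n"
  shows "sweep n C' l x i a = l * (\<Sum>j<i. mv n (C' ! j) (x j) a)
    + ((\<Sum>j=i..<m. mv n (C' ! j) (x j) a) + (mv n (C' ! m) (x m) a + mv n (C' ! Suc m) (x (Suc m)) a))"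
  using assms by (simp add: sweep_def C')

lemma sweep_fine_last:
  "sweep n C' l x (Suc m) a = l * (\<Sum>j<m. mv n (C' ! j) (x j) a)
    + (l * mv n (C' ! m) (x m) a + mv n (C' ! Suc m) (x (Suc m)) a)"
  by (simp add: sweep_def C' algebra_simps)

lemma last_parts:
  "C' ! m \<in> carrier_mat n n" "nonneg_mat (C' ! m)"
  "C' ! Suc m \<in> carrier_mat n n" "nonneg_mat (C' ! Suc m)"
  using nonneg_parts_nth[OF C'(1)] C'(2) by auto

lemma excess_nonneg:
  assumes "\<And>a. a < n \<Longrightarrow> 0 < y a" "a < n"
  shows "0 \<le> mv n (C' ! m) y a" "0 \<le> mv n (C' ! Suc m) (mv n (C' ! m) y) a"
  using assms last_parts by (auto intro!: mv_nonneg simp: less_imp_le)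

lemma fine_less_coarse:
  assumes l: "0 < rho_it n C'" "rho_it n C' < 1"
  shows "rho_it n C' < rho_it n C"
proof -
  define l where "l = rho_it n C'"
  have l: "0 < l" "l < 1" using l by (auto simp: l_def)
  obtain x where x: "sweep_eigen n C' l x" using sweep_eigen_exists[OF C'(1) n] l_def by blast
  have pos: "0 < x i a" if "i < Suc (Suc m)" "a < n" for i a
    using sweep_eigen_positive[OF irr nn x C'(1) l(1)] that C'(2) by simp
  \<comment> \<open>The last two blocks differ by a multiple of \<open>E\<close> applied to
    \<open>x m\<close>. Letting \<open>F\<close> act on \<open>x m\<close> in place of
    \<open>x (Suc m)\<close> thus gains exactly \<open>z\<close>.\<close>
  have step: "x m a - x (Suc m) a = (1/l - 1) * mv n (C' ! m) (x m) a" if "a < n" for a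
    using sweep_eigen_step[OF x _ that, of m] l C'(2) by (simp add: field_simps)
  define z where "z = (\<lambda>a. (1/l - 1) * mv n (C' ! Suc m) (mv n (C' ! m) (x m)) a)"
  have zeq: "mv n (C' ! Suc m) (x m) a - mv n (C' ! Suc m) (x (Suc m)) a = z a" for a
  proof -
    have "mv n (C' ! Suc m) (\<lambda>c. x m c - x (Suc m) c) a
      = mv n (C' ! Suc m) (\<lambda>c. (1/l - 1) * mv n (C' ! m) (x m) c) a" by (rule mv_cong) (rule step)
    then show ?thesis unfolding mv_diff mv_scale z_def .
  qed
  obtain b where b: "b < n" "0 < mv n (C' ! Suc m) (mv n (C' ! m) (x m)) b"
    using mv_mult_pos[OF last_parts ne, of "x m"] pos by auto
  have "l < rho_it n C"
  proof (rule strict_subsolution[OF irr nn C(1) l(1), where y = x and z = z and b' = b and b = b and k = 0])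
    show "0 < z b" using b l by (simp add: z_def)
    show "0 \<le> z a" if "a < n" for a using excess_nonneg(2)[of "x m"] pos that l by (simp add: z_def)
    fix i a assume ia: "i < length C" "a < n"
    then have "sweep n C' l x i a = l * x i a" using x C C' by (simp add: sweep_eigen_def)
    then show "l * x i a + z a \<le> sweep n C l x i a"
      using ia C(2) zeq[of a] by (simp add: sweep_coarse sweep_fine)
  qed (use b pos C in \<open>auto simp: less_imp_le\<close>)
  then show ?thesis by (simp add: l_def)
qed

lemma coarse_less_fine:
  assumes l: "1 < rho_it n C"
  shows "rho_it n C < rho_it n C'"
proof -
  define l where "l = rho_it n C"
  have l: "0 < l" "1 < l" using l by (auto simp: l_def)
  obtain x where x: "sweep_eigen n C l x" using sweep_eigen_exists[OF C(1) n] l_def by blast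
  have pos: "0 < x i a" if "i < Suc m" "a < n" for i a
    using sweep_eigen_positive[OF irr nn x C(1) l(1)] that C(2) by simp
  \<comment> \<open>The appended block continues the recursion of \<open>sweep_eigen_step\<close> by
    one step with the part \<open>E\<close>.\<close>
  define y where "y = (\<lambda>i a. if i = Suc m then x m a + (1 - 1/l) * mv n (C' ! m) (x m) a else x i a)"
  define z where "z = (\<lambda>a. (1 - 1/l) * mv n (C' ! Suc m) (mv n (C' ! m) (x m)) a)"
  have yx: "y i = x i" if "i \<le> m" for i using that by (auto simp: y_def)
  have Fy: "mv n (C' ! Suc m) (y (Suc m)) a = mv n (C' ! Suc m) (x m) a + z a" for a
    by (simp add: y_def z_def mv_add mv_scale)
  have fine: "sweep n C' l y i a = sweep n C l x i a + z a" if "i \<le> m" "a < n" for i a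
    using that by (simp add: sweep_fine sweep_coarse yx Fy)
  obtain b where b: "b < n" "0 < mv n (C' ! Suc m) (mv n (C' ! m) (x m)) b"
    using mv_mult_pos[OF last_parts ne, of "x m"] pos by auto
  have "l < rho_it n C'"
  proof (rule strict_subsolution[OF irr nn C'(1) l(1), where y = y and z = z and b' = b and b = b and k = 0])
    show "0 < z b" using b l by (simp add: z_def)
    show "0 \<le> z a" if "a < n" for a using excess_nonneg(2)[of "x m"] pos that l by (simp add: z_def)
    show "0 \<le> y i a" if "i < length C'" "a < n" for i a
      using that C'(2) pos[of i a] pos[of m a] excess_nonneg(1)[of "x m" a] pos l
      by (auto simp: y_def less_imp_le less_Suc_eq)
    show "0 < y 0 b" using pos b by (simp add: yx)
    fix i a assume ia: "i < length C'" "a < n"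
    show "l * y i a + z a \<le> sweep n C' l y i a"
    proof (cases "i = Suc m")
      case False
      then have "i \<le> m" using ia C' by simp
      then show ?thesis using x ia C(2) by (simp add: fine yx sweep_eigen_def)
    next
      case True
      \<comment> \<open>In row \<open>Suc m\<close> the weight of \<open>E\<close> rises from 1 to
        \<open>l\<close>; the gain \<open>(l - 1) E (x m)\<close> is exactly \<open>l\<close> times
        the increment of the appended block.\<close>
      have "l * x m a = sweep n C l x m a" using x ia C(2) by (simp add: sweep_eigen_def)
      then have "sweep n C' l y i a = l * x m a + (l - 1) * mv n (C' ! m) (x m) a + z a"
        using ia by (simp add: True sweep_fine_last sweep_coarse Fy yx algebra_simps)
      also have "\<dots> = l * y i a + z a" using l by (simp add: True y_def field_simps)
      finally show ?thesis by simp
    qed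
  qed (use b C' in auto)
  then show ?thesis by (simp add: l_def)
qed

end

section \<open>From splittings to nonnegative parts; the three cases\<close>

lemma foldr_add_mat:
  assumes "\<And>X. X \<in> set Bs \<Longrightarrow> X \<in> carrier_mat n n"
  shows "foldr (+) Bs (0\<^sub>m n n) \<in> carrier_mat n n \<and>
    (\<forall>a<n. \<forall>c<n. foldr (+) Bs (0\<^sub>m n n) $$ (a,c) = (\<Sum>X\<leftarrow>Bs. X $$ (a,c)))"
  using assms by (induction Bs) auto

text \<open>Where a part has a nonzero entry all other parts vanish, so the entry equals that of
  \<open>A\<close> and inherits its sign.\<close>

lemma nonneg_parts_of_splitting:
  fixes A :: "real mat"
  assumes nn: "nonneg_mat A" and s: "is_splitting n A Bs"
  shows "nonneg_parts n A Bs"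
proof -
  have carr: "X \<in> carrier_mat n n" "X \<noteq> 0\<^sub>m n n" if "X \<in> set Bs" for X
    using s that by (auto simp: is_splitting_def)
  have A: "A \<in> carrier_mat n n"
    and sum: "\<And>a c. a < n \<Longrightarrow> c < n \<Longrightarrow> (\<Sum>X\<leftarrow>Bs. X $$ (a,c)) = A $$ (a,c)"
    using foldr_add_mat[of Bs n] carr s by (auto simp: is_splitting_def)
  have "nonneg_mat X" if X: "X \<in> set Bs" for X
    unfolding nonneg_mat_def
  proof (intro allI impI)
    obtain p where p: "p < length Bs" "X = Bs ! p" using X by (metis in_set_conv_nth)
    fix a c assume "a < dim_row X" "c < dim_col X"
    then have ac: "a < n" "c < n" using carr(1)[OF X] by auto
    show "0 \<le> X $$ (a,c)"
    proof (cases "X $$ (a,c) = 0")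
      case False
      have "(Bs ! q) $$ (a,c) = 0" if "q < length Bs" "q \<noteq> p" for q
      proof -
        have "hadamard_zero X (Bs ! q)" using s p that by (simp add: is_splitting_def)
        then show ?thesis using False ac carr(1)[OF X] by (auto simp: hadamard_zero_def)
      qed
      then have "(\<Sum>q\<in>{..<length Bs} - {p}. (Bs ! q) $$ (a,c)) = 0" by (intro sum.neutral) auto
      then have "A $$ (a,c) = X $$ (a,c)"
        using sum[OF ac] p
        by (simp add: sum_list_sum_nth atLeast0LessThan sum.remove[of "{..<length Bs}" p])
      moreover have "0 \<le> A $$ (a,c)" using nn A ac by (auto simp: nonneg_mat_def)
      ultimately show ?thesis by simp
    qed simp
  qed
  then show ?thesis using carr sum s by (auto simp: nonneg_parts_def is_splitting_def)
qed

theorem theorem3p2: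
  fixes n :: nat and BJ :: "real mat" and Bs Bs' :: "real mat list"
  assumes "BJ \<in> carrier_mat n n"
    and "irreducible_mat n BJ"
    and "nonneg_mat BJ"
    and "real_spectral_radius BJ > 0"
    and "is_splitting n BJ Bs"
    and "is_splitting n BJ Bs'"
    and "length Bs' = length Bs + 1"
    and "refines n Bs' Bs"
  shows "(real_spectral_radius BJ < 1 \<longrightarrow>
            real_spectral_radius (iteration_mat n Bs') < real_spectral_radius (iteration_mat n Bs) \<and>
            real_spectral_radius (iteration_mat n Bs) \<le> real_spectral_radius BJ)
       \<and> (real_spectral_radius BJ = 1 \<longrightarrow>
            real_spectral_radius (iteration_mat n Bs') = 1 \<and>
            real_spectral_radius (iteration_mat n Bs) = 1)
       \<and> (real_spectral_radius BJ > 1 \<longrightarrow>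
            real_spectral_radius (iteration_mat n Bs') > real_spectral_radius (iteration_mat n Bs) \<and>
            real_spectral_radius (iteration_mat n Bs) \<ge> real_spectral_radius BJ)"
proof -
  note A = assms(1,3) and irr = assms(2)
  have P: "nonneg_parts n BJ Bs" and P': "nonneg_parts n BJ Bs'"
    using nonneg_parts_of_splitting assms by blast+
  \<comment> \<open>In dimension 0 every matrix is the zero matrix, whereas the parts are
    nonzero.\<close>
  have n: "n > 0"
  proof (rule ccontr)
    assume "\<not> n > 0"
    moreover have "0 < length Bs" using P by (simp add: nonneg_parts_def)
    ultimately show False using nonneg_parts_nth(1,3)[OF P, of 0] by (auto intro!: eq_matI)
  qed
  obtain m where m: "length Bs = Suc m" using P by (cases Bs) (auto simp: nonneg_parts_def)
  obtain r s where rs: "\<And>p. p < m \<Longrightarrow> (cyc_shift ^^ s) Bs' ! p = (cyc_shift ^^ r) Bs ! p"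
    "is_splitting n ((cyc_shift ^^ r) Bs ! m) [(cyc_shift ^^ s) Bs' ! m, (cyc_shift ^^ s) Bs' ! Suc m]"
    "(cyc_shift ^^ s) Bs' ! Suc m * (cyc_shift ^^ s) Bs' ! m \<noteq> 0\<^sub>m n n"
    using assms(8) unfolding refines_def Let_def m by auto
  define C where "C = (cyc_shift ^^ r) Bs"
  define C' where "C' = (cyc_shift ^^ s) Bs'"
  interpret refinement n BJ C C' m
  proof
    show "(C ! m) $$ (a,c) = (C' ! m) $$ (a,c) + (C' ! Suc m) $$ (a,c)" if "a < n" "c < n" for a c
    proof -
      have "C ! m = C' ! m + C' ! Suc m" "C' ! m \<in> carrier_mat n n" "C' ! Suc m \<in> carrier_mat n n"
        using rs(2) by (auto simp: is_splitting_def C_def C'_def)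
      then show ?thesis using that by simp
    qed
  qed (use irr A n rs m assms(7) cyc_shift_funpow_props(1,2)[OF P] cyc_shift_funpow_props(1,2)[OF P']
      in \<open>simp_all add: C_def C'_def\<close>)
  have rho: "rho_it n C = rho_it n Bs" "rho_it n C' = rho_it n Bs'"
    using rho_it_cyc_shift[OF P n] rho_it_cyc_shift[OF P' n] by (simp_all add: C_def C'_def)
  note le = iteration_le_if_le_1[OF A _ n] and gt = iteration_gt_1[OF irr A(2) _ n]
    and ge = iteration_ge_if_ge_1[OF A _ n]
  show ?thesis
  proof (intro conjI impI)
    assume lt: "real_spectral_radius BJ < 1"
    \<comment> \<open>Excluding values above 1 comes first, because the comparison \<open>le\<close>
      is available only for spectral radii of \<open>T\<close> up to 1.\<close>
    have le1: "rho_it n Bs \<le> 1" "rho_it n Bs' \<le> 1" using gt[OF P] gt[OF P'] lt by linarith+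
    show "rho_it n Bs \<le> real_spectral_radius BJ" using le[OF P le1(1)] .
    have "rho_it n Bs' < 1" using le[OF P' le1(2)] lt by simp
    \<comment> \<open>Positivity is required because the excess in \<open>fine_less_coarse\<close>
      contains \<open>1/l\<close>.\<close>
    moreover have "0 < rho_it n Bs'"
      using iteration_spectral_radius_pos[OF A P' n assms(4)] lt by simp
    ultimately show "rho_it n Bs' < rho_it n Bs" using fine_less_coarse rho by simp
  next
    assume "real_spectral_radius BJ = 1"
    \<comment> \<open>Squeezed: \<open>gt\<close> excludes values above 1 and \<open>ge\<close>
      excludes values below 1.\<close>
    then show "rho_it n Bs' = 1" "rho_it n Bs = 1"
      using gt[OF P] gt[OF P'] ge[OF P] ge[OF P'] by linarith+
  next
    assume 1: "real_spectral_radius BJ > 1"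
    show b: "real_spectral_radius BJ \<le> rho_it n Bs" using ge[OF P] 1 by simp
    then show "rho_it n Bs' > rho_it n Bs" using coarse_less_fine 1 rho by simp
  qed
qed

end
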